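(* Let $X,Z$ be Hilbert spaces, let $E\in L(X,Z)$, and let $A:X\supseteq D(A)\to Z$ be closed and densely defined. Assume that $0\in\rho(A)$, i.e. $A:D(A)\to Z$ is bijective (so that $0\in\rho(E,A)$), and that there exists $\omega>0$ such that $$\operatorname{Re}\langle Ax,Ex\rangle_Z\le-\omega\|Ex\|^2\quad\text{for all }x\in D(A),$$ $$\operatorname{Re}\langle A^*x,E^*x\rangle_X\le-\omega\|E^*x\|^2\quad\text{for all }x\in D(A^* ).$$ Then: 1) $(-\omega,\infty)\subseteq\rho(E,A)$ and $(-\omega,\infty)\subseteq\rho(E^*,A^* )$; 2) $\|E(\lambda E-A)^{-1}\|\le(\lambda+\omega)^{-1}$ for all $\lambda>-\omega$; 3) $\|(\lambda E-A)^{-1}E\|\le(\lambda+\omega)^{-1}$ for all $\lambda>-\omega$. In particular, the degenerate semigroup associated with the pseudo-resolvent $\lambda\mapsto(A-\lambda E)^{-1}E$ is exponentially stable.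
   Context: The resolvent set of the pair $(E,A)$ is $\rho(E,A):=\{\lambda\in\mathbb{C}:\lambda E-A:D(A)\to Z\text{ is bijective}\}$, and $\rho(E^*,A^* )$ is defined analogously with $A^*:Z\supseteq D(A^* )\to X$ and $E^*\in L(Z,X)$. Put $R(\lambda):=(A-\lambda E)^{-1}E\in L(X)$ for $\lambda\in\rho(E,A)$. If $\|R(\lambda)\|\le M/(\lambda-\omega_0)$ for all real $\lambda>\omega_0$ (for some $M>0$, $\omega_0\in\mathbb{R}$, with $(\omega_0,\infty)\subseteq\rho(E,A)$), then $X$ is the direct sum $X=X_K\dotplus X_R$ of the closed subspaces $X_K=\ker R(\lambda)$ and $X_R=\overline{\operatorname{ran}R(\lambda)}$, which do not depend on $\lambda$. The operator $A_R$ on $X_R$ is defined by $\operatorname{graph}A_R=\{(R(\lambda)x,\,x+\lambda R(\lambda)x):x\in X_R\}$, independently of $\lambda$; thus $(A_R-\lambda I)^{-1}=R(\lambda)|_{X_R}$. When $A_R$ generates a $C_0$-semigroup $(T_R(t))_{t\ge0}$ on $X_R$, the degenerate semigroup associated with the pseudo-resolvent $R$ is $T(t)(x_0+x_1):=T_R(t)x_1$ for $x_0\in X_K$, $x_1\in X_R$, $t\ge0$. It is exponentially stable if there exist $M',\delta>0$ with $\|T(t)\|\le M'e^{-\delta t}$ for all $t\ge0$. *)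

theory Defs
  imports "HOL-Analysis.Analysis"
begin

section \<open>Complex Hilbert spaces\<close>

text \<open>
  The inner product is linear in the first argument. The last axiom combines positivity with
  the requirement that the norm be the one induced by the inner product; definiteness is then
  inherited from the norm.
\<close>

class complex_inner = real_normed_vector +
  fixes scaleC :: "complex \<Rightarrow> 'a \<Rightarrow> 'a" (infixr \<open>*\<^sub>C\<close> 75)
    and cinner :: "'a \<Rightarrow> 'a \<Rightarrow> complex"
  assumes scaleC_add_right: "c *\<^sub>C (x + y) = c *\<^sub>C x + c *\<^sub>C y"
    and scaleC_add_left: "(c + d) *\<^sub>C x = c *\<^sub>C x + d *\<^sub>C x"
    and scaleC_scaleC: "c *\<^sub>C (d *\<^sub>C x) = (c * d) *\<^sub>C x"
    and scaleR_scaleC: "r *\<^sub>R x = complex_of_real r *\<^sub>C x"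
    and cinner_commute: "cinner x y = cnj (cinner y x)"
    and cinner_add_left: "cinner (x + y) z = cinner x z + cinner y z"
    and cinner_scaleC_left: "cinner (c *\<^sub>C x) y = c * cinner x y"
    and cinner_self: "cinner x x = complex_of_real ((norm x)\<^sup>2)"

class complex_hilbert = complex_inner + complete_space

instance complex_hilbert \<subseteq> banach ..

instantiation complex :: complex_hilbert
begin

definition scaleC_complex :: "complex \<Rightarrow> complex \<Rightarrow> complex"
  where "scaleC_complex c x = c * x"

definition cinner_complex :: "complex \<Rightarrow> complex \<Rightarrow> complex"
  where "cinner_complex x y = x * cnj y"

instance
proof
  show "cinner x x = complex_of_real ((norm x)\<^sup>2)" for x :: complex
    using complex_norm_square[of x] by (simp add: cinner_complex_def)
qed (simp_all add: scaleC_complex_def cinner_complex_def algebra_simps scaleR_conv_of_real)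

end

global_interpretation complex_vector:
  vector_space "scaleC :: complex \<Rightarrow> 'a \<Rightarrow> 'a::complex_inner"
proof
  show "1 *\<^sub>C x = x" for x :: 'a
    using scaleR_scaleC[of 1 x] by simp
qed (simp_all add: scaleC_add_right scaleC_add_left scaleC_scaleC)


section \<open>Bounded and unbounded operators\<close>

definition bounded_clinear :: "('a::complex_inner \<Rightarrow> 'b::complex_inner) \<Rightarrow> bool"
  where "bounded_clinear f \<longleftrightarrow> bounded_linear f \<and> (\<forall>c x. f (c *\<^sub>C x) = c *\<^sub>C f x)"

text \<open>
  An operator with domain \<^term>\<open>D\<close> is given by \<^term>\<open>D\<close> together with a function; the values of the
  function outside \<^term>\<open>D\<close> are irrelevant.
\<close>

definition clinear_on :: "'a::complex_inner set \<Rightarrow> ('a \<Rightarrow> 'b::complex_inner) \<Rightarrow> bool"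
  where "clinear_on D A \<longleftrightarrow> complex_vector.subspace D \<and>
    (\<forall>x\<in>D. \<forall>y\<in>D. A (x + y) = A x + A y) \<and>
    (\<forall>c. \<forall>x\<in>D. A (c *\<^sub>C x) = c *\<^sub>C A x)"

definition op_graph :: "'a set \<Rightarrow> ('a \<Rightarrow> 'b) \<Rightarrow> ('a \<times> 'b) set"
  where "op_graph D A = {(x, A x) |x. x \<in> D}"

definition closed_op :: "'a::complex_inner set \<Rightarrow> ('a \<Rightarrow> 'b::complex_inner) \<Rightarrow> bool"
  where "closed_op D A \<longleftrightarrow> closed (op_graph D A)"

definition densely_defined :: "'a::complex_inner set \<Rightarrow> bool"
  where "densely_defined D \<longleftrightarrow> closure D = UNIV"

definition adj_dom :: "'a::complex_inner set \<Rightarrow> ('a \<Rightarrow> 'b::complex_inner) \<Rightarrow> 'b set"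
  where "adj_dom D A = {y. \<exists>z. \<forall>x\<in>D. cinner (A x) y = cinner x z}"

text \<open>
  Meaningful for densely defined operators, where the representing vector is unique. The adjoint
  of an everywhere defined bounded operator \<^term>\<open>E\<close> is \<^term>\<open>adj UNIV E\<close>.
\<close>

definition adj :: "'a::complex_inner set \<Rightarrow> ('a \<Rightarrow> 'b::complex_inner) \<Rightarrow> 'b \<Rightarrow> 'a"
  where "adj D A y = (THE z. \<forall>x\<in>D. cinner (A x) y = cinner x z)"

text \<open>In the following three definitions \<^term>\<open>D\<close> is the domain of \<^term>\<open>A\<close>.\<close>

definition resolvent_set ::
    "('a::complex_inner \<Rightarrow> 'b::complex_inner) \<Rightarrow> 'a set \<Rightarrow> ('a \<Rightarrow> 'b) \<Rightarrow> complex set"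
  where "resolvent_set E D A = {\<mu>. bij_betw (\<lambda>x. \<mu> *\<^sub>C E x - A x) D UNIV}"

text \<open>$(\mu E - A)^{-1}$\<close>

definition pair_resolvent ::
    "('a::complex_inner \<Rightarrow> 'b::complex_inner) \<Rightarrow> 'a set \<Rightarrow> ('a \<Rightarrow> 'b) \<Rightarrow> complex \<Rightarrow> 'b \<Rightarrow> 'a"
  where "pair_resolvent E D A \<mu> = inv_into D (\<lambda>x. \<mu> *\<^sub>C E x - A x)"

text \<open>$(A - \mu E)^{-1} E$; note the opposite sign\<close>

definition pseudo_resolvent ::
    "('a::complex_inner \<Rightarrow> 'b::complex_inner) \<Rightarrow> 'a set \<Rightarrow> ('a \<Rightarrow> 'b) \<Rightarrow> complex \<Rightarrow> 'a \<Rightarrow> 'a"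
  where "pseudo_resolvent E D A \<mu> = inv_into D (\<lambda>x. A x - \<mu> *\<^sub>C E x) \<circ> E"


section \<open>Semigroups\<close>

text \<open>Only the values \<^term>\<open>T t x\<close> with \<^term>\<open>t \<ge> 0\<close> and \<^term>\<open>x \<in> V\<close> matter.\<close>

definition C0_semigroup_on :: "'a::complex_inner set \<Rightarrow> (real \<Rightarrow> 'a \<Rightarrow> 'a) \<Rightarrow> bool"
  where "C0_semigroup_on V T \<longleftrightarrow>
    (\<forall>t\<ge>0. clinear_on V (T t) \<and> T t ` V \<subseteq> V \<and> (\<exists>K. \<forall>x\<in>V. norm (T t x) \<le> K * norm x)) \<and>
    (\<forall>x\<in>V. T 0 x = x) \<and>
    (\<forall>s\<ge>0. \<forall>t\<ge>0. \<forall>x\<in>V. T (s + t) x = T s (T t x)) \<and>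
    (\<forall>x\<in>V. ((\<lambda>t. T t x) \<longlongrightarrow> x) (at_right 0))"

definition generator_graph :: "'a::complex_inner set \<Rightarrow> (real \<Rightarrow> 'a \<Rightarrow> 'a) \<Rightarrow> ('a \<times> 'a) set"
  where "generator_graph V T =
    {(x, y). x \<in> V \<and> y \<in> V \<and> ((\<lambda>t. (1 / t) *\<^sub>R (T t x - x)) \<longlongrightarrow> y) (at_right 0)}"

definition closed_direct_sum :: "'a::complex_inner set \<Rightarrow> 'a set \<Rightarrow> bool"
  where "closed_direct_sum U V \<longleftrightarrow>
    complex_vector.subspace U \<and> closed U \<and> complex_vector.subspace V \<and> closed V \<and>
    U \<inter> V = {0} \<and> (\<forall>x. \<exists>u\<in>U. \<exists>v\<in>V. x = u + v)"

text \<open>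
  \<^term>\<open>T\<close> is the degenerate semigroup associated with the pseudo-resolvent \<^term>\<open>R\<close> on \<^term>\<open>\<Lambda>\<close>.
  The existential variables are $X_K$, $X_R$, the graph of $A_R$ and the semigroup $T_R$ on $X_R$
  generated by $A_R$. The quantifier over \<^term>\<open>\<mu>\<close> expresses that the first three do not depend
  on it; the set \<^term>\<open>\<Lambda>\<close> is nonempty by the first conjunct.
\<close>

definition degenerate_semigroup ::
    "complex set \<Rightarrow> (complex \<Rightarrow> 'a::complex_inner \<Rightarrow> 'a) \<Rightarrow> (real \<Rightarrow> 'a \<Rightarrow> 'a) \<Rightarrow> bool"
  where "degenerate_semigroup \<Lambda> R T \<longleftrightarrow>
    (\<exists>M>0. \<exists>\<omega>\<^sub>0. \<forall>\<mu>>\<omega>\<^sub>0. complex_of_real \<mu> \<in> \<Lambda> \<and>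
       bounded_clinear (R (complex_of_real \<mu>)) \<and> onorm (R (complex_of_real \<mu>)) \<le> M / (\<mu> - \<omega>\<^sub>0)) \<and>
    (\<exists>X\<^sub>K X\<^sub>R G\<^sub>R T\<^sub>R.
       (\<forall>\<mu>\<in>\<Lambda>. X\<^sub>K = {x. R \<mu> x = 0} \<and> X\<^sub>R = closure (range (R \<mu>)) \<and>
          G\<^sub>R = {(R \<mu> x, x + \<mu> *\<^sub>C R \<mu> x) |x. x \<in> X\<^sub>R}) \<and>
       closed_direct_sum X\<^sub>K X\<^sub>R \<and>
       C0_semigroup_on X\<^sub>R T\<^sub>R \<and> generator_graph X\<^sub>R T\<^sub>R = G\<^sub>R \<and>
       (\<forall>t\<ge>0. \<forall>x\<^sub>0\<in>X\<^sub>K. \<forall>x\<^sub>1\<in>X\<^sub>R. T t (x\<^sub>0 + x\<^sub>1) = T\<^sub>R t x\<^sub>1))"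

definition exponentially_stable :: "(real \<Rightarrow> 'a::complex_inner \<Rightarrow> 'a) \<Rightarrow> bool"
  where "exponentially_stable T \<longleftrightarrow>
    (\<exists>M>0. \<exists>\<delta>>0. \<forall>t\<ge>0. bounded_clinear (T t) \<and> onorm (T t) \<le> M * exp (- \<delta> * t))"

end

theory Submission
  imports Defs
begin

text \<open>
  Put \<open>B = A\<inverse>\<close>, which is bounded by the closed graph theorem. Each of the hypotheses says that
  one of the bounded operators \<open>K = E B\<close> and \<open>K = E\<^sup>* B\<^sup>*\<close> satisfies
  \<open>Re \<langle>x, K x\<rangle> \<le> - \<omega> \<parallel>K x\<parallel>\<^sup>2\<close>, and this property passes to adjoints, so that \<open>Q = B E\<close> has it as well.
  It gives \<open>(\<lambda> + \<omega>) \<parallel>K x\<parallel> \<le> \<parallel>x - \<lambda> K x\<parallel>\<close>, hence the bijectivity of \<open>1 - \<lambda> K\<close> for \<open>\<lambda> > - \<omega>\<close> and all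
  resolvent bounds, because \<open>\<lambda> E - A = (\<lambda> E B - 1) A\<close>.
  The pseudo-resolvent is determined by \<open>R(\<lambda>) v = y \<longleftrightarrow> y = Q (v + \<lambda> y)\<close>. Therefore its kernel and
  range are those of \<open>Q\<close>, which are orthogonal because \<open>Q\<close> and its adjoint have the same kernel, and
  \<open>A\<^sub>R\<close> is the inverse of \<open>Q\<close> on the closure \<open>V\<close> of the range of \<open>Q\<close>. The semigroup generated by
  \<open>A\<^sub>R\<close> is the limit of the semigroups generated by the Yosida approximants \<open>- n (1 - n Q)\<inverse>\<close>. It
  decays like \<open>exp (- \<omega> t)\<close> since \<open>Re \<langle>A\<^sub>R x, x\<rangle> \<le> - \<omega> \<parallel>x\<parallel>\<^sup>2\<close>.
\<close>

section \<open>Hilbert space geometry\<close>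

text \<open>The two hypotheses live on different spaces. The first says that E B is dissipative on
  Z, which controls E (l E - A)^{-1}; the second is about an operator on X whose adjoint is Q = B E,
  which controls (l E - A)^{-1} E and the semigroup. Since Q may have a kernel, A_R is available
  only as the relation of pairs \<open>(Q u, u)\<close> with u in V. It is therefore never formed as
  an operator: generation, dissipativity and decay are all phrased as properties of the bounded
  operator Q. As V is a subset and not a type, theorems about operators on a whole Banach space are
  reached by precomposing with the projection onto V. The definition of a degenerate semigroup fixes
  T_R only through its generator, so stability is needed for every semigroup with that generator,
  while the Yosida limit settles existence. The energy estimate is applied directly to the orbits of
  an arbitrary one; their differentiability rests on the uniform boundedness principle. The
  approximants are used only with dissipativity constant 0; the rate \<open>w\<close> enters through
  this final estimate.\<close>

lemma Re_cinner_self: "Re (cinner x x) = (norm x)\<^sup>2"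
  by (simp add: cinner_self)

lemma cinner_add_right: "cinner x (y + z) = cinner x y + cinner x z"
  by (metis cinner_add_left cinner_commute complex_cnj_add)

lemma cinner_scaleC_right: "cinner x (c *\<^sub>C y) = cnj c * cinner x y"
  by (metis cinner_commute cinner_scaleC_left complex_cnj_mult)

lemma scaleC_minus_one: "(- 1) *\<^sub>C (x::'a::complex_inner) = - x"
  using scaleR_scaleC[of "-1" x] by simp

lemma scaleC_minus_right: "c *\<^sub>C (- x) = - (c *\<^sub>C (x::'a::complex_inner))"
  by (simp add: complex_vector.scale_minus_right)

lemma scaleC_diff_right: "c *\<^sub>C (x - y) = c *\<^sub>C x - c *\<^sub>C (y::'a::complex_inner)"
  by (rule complex_vector.scale_right_diff_distrib)

lemma cinner_minus_left: "cinner (- x) y = - cinner x y"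
  using cinner_scaleC_left[of "-1" x y] by (simp add: scaleC_minus_one)

lemma cinner_minus_right: "cinner x (- y) = - cinner x y"
  using cinner_scaleC_right[of x "-1" y] by (simp add: scaleC_minus_one)

lemma cinner_diff_left: "cinner (x - y) z = cinner x z - cinner y z"
  using cinner_add_left[of x "- y" z] by (simp add: cinner_minus_left)

lemma cinner_diff_right: "cinner x (y - z) = cinner x y - cinner x z"
  using cinner_add_right[of x y "- z"] by (simp add: cinner_minus_right)

lemma cinner_scaleR_left: "cinner (r *\<^sub>R x) y = complex_of_real r * cinner x y"
  by (simp add: scaleR_scaleC cinner_scaleC_left)

lemma cinner_scaleR_right: "cinner x (r *\<^sub>R y) = complex_of_real r * cinner x y"
  by (simp add: scaleR_scaleC cinner_scaleC_right)

lemma cinner_zero_left [simp]: "cinner 0 y = 0"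
  using cinner_scaleR_left[of 0 0 y] by simp

lemma cinner_zero_right [simp]: "cinner x 0 = 0"
  using cinner_scaleR_right[of x 0 0] by simp

lemmas cinner_simps = cinner_add_left cinner_add_right cinner_diff_left cinner_diff_right
  cinner_minus_left cinner_minus_right cinner_scaleR_left cinner_scaleR_right
  cinner_scaleC_left cinner_scaleC_right

lemma Re_cinner_commute: "Re (cinner x y) = Re (cinner y x)"
  by (subst cinner_commute) simp

lemma norm_add_sq: "(norm (x + y))\<^sup>2 = (norm x)\<^sup>2 + 2 * Re (cinner x y) + (norm (y::'a::complex_inner))\<^sup>2"
  using Re_cinner_commute[of y x]
  by (simp add: Re_cinner_self[symmetric] cinner_simps)

lemma norm_diff_sq: "(norm (x - y))\<^sup>2 = (norm x)\<^sup>2 - 2 * Re (cinner x y) + (norm (y::'a::complex_inner))\<^sup>2"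
  using Re_cinner_commute[of y x]
  by (simp add: Re_cinner_self[symmetric] cinner_simps)

lemma norm_scaleC: "norm (c *\<^sub>C (x::'a::complex_inner)) = cmod c * norm x"
proof -
  have "complex_of_real ((norm (c *\<^sub>C x))\<^sup>2) = (c * cnj c) * complex_of_real ((norm x)\<^sup>2)"
    unfolding cinner_self[symmetric] by (simp only: cinner_simps mult_ac)
  also have "\<dots> = complex_of_real ((cmod c * norm x)\<^sup>2)"
    by (simp only: complex_norm_square[symmetric] of_real_mult[symmetric] power_mult_distrib)
  finally have "(norm (c *\<^sub>C x))\<^sup>2 = (cmod c * norm x)\<^sup>2"
    using of_real_eq_iff by blast
  thus ?thesis by (simp add: power2_eq_iff_nonneg)
qed

lemma Re_cinner_le_norm: "Re (cinner x y) \<le> norm x * norm (y::'a::complex_inner)"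
proof (cases "norm y = 0")
  case False
  define a where "a = norm y"
  define b where "b = norm x"
  have a: "a > 0" using False by (simp add: a_def)
  \<comment> \<open>The weights give both vectors the same norm, so the expanded square factors as 2
    a b (a b - Re <x, y>).\<close>
  have "0 \<le> (norm (a *\<^sub>R x - b *\<^sub>R y))\<^sup>2" by simp
  also have "\<dots> = (norm (a *\<^sub>R x))\<^sup>2 - 2 * Re (cinner (a *\<^sub>R x) (b *\<^sub>R y)) + (norm (b *\<^sub>R y))\<^sup>2"
    by (rule norm_diff_sq)
  also have "\<dots> = 2 * a * b * (a * b - Re (cinner x y))"
    by (simp add: cinner_simps a_def b_def power2_eq_square algebra_simps)
  finally have "0 \<le> 2 * a * b * (a * b - Re (cinner x y))" .
  hence le: "0 \<le> (2 * a * b) * (a * b - Re (cinner x y))" by (simp only: mult.assoc)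
  show ?thesis
  proof (cases "x = 0")
    case False
    hence "0 < 2 * a * b" using a by (simp add: b_def)
    with le have "0 \<le> a * b - Re (cinner x y)" using zero_le_mult_iff[of "2 * a * b" "a * b - Re (cinner x y)"] by linarith
    thus ?thesis by (simp add: a_def b_def mult.commute)
  qed simp
qed simp

lemma cmod_cinner_le: "cmod (cinner x y) \<le> norm x * norm (y::'a::complex_inner)"
proof (cases "cinner x y = 0")
  case False
  \<comment> \<open>The phase that rotates the inner product onto the positive real axis.\<close>
  define c where "c = cnj (cinner x y) / cmod (cinner x y)"
  have "cmod c = 1" using False by (simp add: c_def norm_divide)
  have "c * cinner x y = cmod (cinner x y)"
    using False complex_norm_square[of "cinner x y"]
    by (simp add: c_def field_simps power2_eq_square)
  hence "cmod (cinner x y) = Re (cinner (c *\<^sub>C x) y)"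
    by (simp add: cinner_simps)
  also have "\<dots> \<le> norm (c *\<^sub>C x) * norm y" by (rule Re_cinner_le_norm)
  finally show ?thesis by (simp add: norm_scaleC \<open>cmod c = 1\<close>)
qed simp

lemma bounded_bilinear_Re_cinner: "bounded_bilinear (\<lambda>x y. Re (cinner x (y::'a::complex_inner)))"
proof (unfold_locales, goal_cases)
  case 5
  have "norm (Re (cinner a b)) \<le> norm a * norm b * 1" for a b :: 'a
    using abs_Re_le_cmod[of "cinner a b"] cmod_cinner_le[of a b] by simp
  then show ?case by blast
qed (simp_all add: cinner_simps)

lemma bounded_bilinear_cinner: "bounded_bilinear (\<lambda>x y. cinner x (y::'a::complex_inner))"
proof (unfold_locales, goal_cases)
  case 5
  have "norm (cinner a b) \<le> norm a * norm b * 1" for a b :: 'a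
    using cmod_cinner_le[of a b] by simp
  then show ?case by blast
qed (simp_all add: cinner_simps scaleR_conv_of_real)

lemma bounded_linear_scaleC: "bounded_linear (\<lambda>x. c *\<^sub>C (x::'a::complex_inner))"
proof (rule bounded_linear_intro[where K = "cmod c"])
  show "c *\<^sub>C (r *\<^sub>R x) = r *\<^sub>R (c *\<^sub>C x)" for r and x :: 'a
    by (simp add: scaleR_scaleC scaleC_scaleC mult.commute)
qed (simp_all add: scaleC_add_right norm_scaleC mult.commute)

lemma bounded_clinear_bounded_linear: "bounded_clinear f \<Longrightarrow> bounded_linear f"
  by (simp add: bounded_clinear_def)

lemma bounded_clinear_scaleC: "bounded_clinear f \<Longrightarrow> f (c *\<^sub>C x) = c *\<^sub>C f x"
  by (simp add: bounded_clinear_def)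

lemma bounded_clinearI:
  assumes "\<And>x y. f (x + y) = f x + f y" and "\<And>c x. f (c *\<^sub>C x) = c *\<^sub>C f x"
    and "\<And>x. norm (f x) \<le> C * norm x"
  shows "bounded_clinear f"
proof -
  have "bounded_linear f"
    by (rule bounded_linear_intro[where K = C]) (use assms in \<open>auto simp: scaleR_scaleC mult.commute\<close>)
  thus ?thesis using assms by (simp add: bounded_clinear_def)
qed

lemma bounded_clinear_minus:
  assumes "bounded_clinear f"
  shows "bounded_clinear (\<lambda>x. - f x)"
  using assms bounded_linear_minus unfolding bounded_clinear_def by (auto simp: scaleC_minus_right)

lemma subspace_scaleR:
  "complex_vector.subspace V \<Longrightarrow> x \<in> V \<Longrightarrow> r *\<^sub>R x \<in> V"
  by (simp add: scaleR_scaleC complex_vector.subspace_scale)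

lemma subspace_closure:
  assumes "complex_vector.subspace V"
  shows "complex_vector.subspace (closure V)"
proof (rule complex_vector.subspaceI)
  show "0 \<in> closure V"
    using complex_vector.subspace_0[OF assms] closure_subset by blast
next
  fix x y assume "x \<in> closure V" "y \<in> closure V"
  then obtain u v where "\<And>n. u n \<in> V" "u \<longlonglongrightarrow> x" "\<And>n. v n \<in> V" "v \<longlonglongrightarrow> y"
    unfolding closure_sequential by blast
  thus "x + y \<in> closure V"
    unfolding closure_sequential
    by (intro exI[of _ "\<lambda>n. u n + v n"])
      (auto intro!: tendsto_add complex_vector.subspace_add[OF assms])
next
  fix c x assume "x \<in> closure V"
  then obtain u where "\<And>n. u n \<in> V" "u \<longlonglongrightarrow> x"
    unfolding closure_sequential by blast
  thus "c *\<^sub>C x \<in> closure V"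
    unfolding closure_sequential
    by (intro exI[of _ "\<lambda>n. c *\<^sub>C u n"])
      (auto intro!: bounded_linear.tendsto[OF bounded_linear_scaleC]
        complex_vector.subspace_scale[OF assms])
qed

section \<open>Orthogonal projection and the Riesz representation\<close>

lemma parallelogram:
  "(norm (x + y))\<^sup>2 + (norm (x - y))\<^sup>2 = 2 * (norm x)\<^sup>2 + 2 * (norm (y::'a::complex_inner))\<^sup>2"
  by (simp add: norm_add_sq norm_diff_sq)

text \<open>Midpoints of a minimising sequence stay in M and so have squared distance at least
  \<open>d\<close>; the parallelogram law then leaves no room for the members to be far apart, and
  completeness supplies the limit.\<close>

lemma nearest_point_exists:
  fixes M :: "'a::complex_hilbert set"
  assumes M: "complex_vector.subspace M" and cl: "closed M"
  shows "\<exists>m\<in>M. \<forall>y\<in>M. norm (x - m) \<le> norm (x - y)"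
proof -
  have ne: "M \<noteq> {}" using complex_vector.subspace_0[OF M] by blast
  define d where "d = (INF m\<in>M. (norm (x - m))\<^sup>2)"
  have bdd: "bdd_below ((\<lambda>m. (norm (x - m))\<^sup>2) ` M)"
    by (rule bdd_belowI[of _ 0]) auto
  have dle: "d \<le> (norm (x - m))\<^sup>2" if "m \<in> M" for m
    unfolding d_def by (rule cINF_lower[OF bdd that])
  have "\<exists>m\<in>M. (norm (x - m))\<^sup>2 < d + inverse (Suc n)" for n
    using cINF_less_iff[OF ne bdd, of "d + inverse (Suc n)"] unfolding d_def by auto
  then obtain m where m: "\<And>n. m n \<in> M" "\<And>n. (norm (x - m n))\<^sup>2 < d + inverse (Suc n)"
    by metis
  have est: "(norm (m i - m j))\<^sup>2 \<le> 2 * inverse (Suc i) + 2 * inverse (Suc j)" for i j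
  proof -
    have "(1/2) *\<^sub>R (m i + m j) \<in> M"
      by (intro subspace_scaleR[OF M] complex_vector.subspace_add[OF M] m)
    from dle[OF this] have 1: "4 * d \<le> 4 * (norm (x - (1/2) *\<^sub>R (m i + m j)))\<^sup>2" by simp
    have "(x - m i) + (x - m j) = 2 *\<^sub>R (x - (1/2) *\<^sub>R (m i + m j))"
      by (simp add: algebra_simps scaleR_2)
    hence 2: "(norm ((x - m i) + (x - m j)))\<^sup>2 = 4 * (norm (x - (1/2) *\<^sub>R (m i + m j)))\<^sup>2"
      by (simp add: power_mult_distrib)
    have 3: "(x - m i) - (x - m j) = m j - m i" by simp
    show ?thesis
      using parallelogram[of "x - m i" "x - m j"] m(2)[of i] m(2)[of j] 1 2 
      unfolding 3 by (simp add: norm_minus_commute)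
  qed
  have "Cauchy m"
  proof (rule metric_CauchyI)
    fix e :: real assume e: "e > 0"
    then obtain N where N: "inverse (real (Suc N)) < e\<^sup>2 / 4"
      using reals_Archimedean[of "e\<^sup>2 / 4"] by auto
    have "dist (m i) (m j) < e" if "i \<ge> N" "j \<ge> N" for i j
    proof -
      have "inverse (real (Suc i)) \<le> inverse (real (Suc N))" "inverse (real (Suc j)) \<le> inverse (real (Suc N))"
        using that by (auto simp: field_simps)
      hence "(norm (m i - m j))\<^sup>2 < e\<^sup>2" using est[of i j] N by linarith
      thus ?thesis using e by (simp add: dist_norm power_less_imp_less_base)
    qed
    thus "\<exists>N. \<forall>i\<ge>N. \<forall>j\<ge>N. dist (m i) (m j) < e" by blast
  qed
  then obtain l where l: "m \<longlonglongrightarrow> l" using Cauchy_convergent convergent_def by blast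
  have lM: "l \<in> M" using closed_sequentially[OF cl _ l] m by blast
  have "(norm (x - l))\<^sup>2 \<le> d"
  proof (rule LIMSEQ_le)
    show "(\<lambda>n. (norm (x - m n))\<^sup>2) \<longlonglongrightarrow> (norm (x - l))\<^sup>2"
      by (intro tendsto_intros l)
    have "(\<lambda>n. d + inverse (real (Suc n))) \<longlonglongrightarrow> d + 0"
      by (intro tendsto_intros LIMSEQ_inverse_real_of_nat)
    thus "(\<lambda>n. d + inverse (real (Suc n))) \<longlonglongrightarrow> d" by simp
    show "\<exists>N. \<forall>n\<ge>N. (norm (x - m n))\<^sup>2 \<le> d + inverse (real (Suc n))"
      using m(2) less_imp_le by blast
  qed
  hence "norm (x - l) \<le> norm (x - y)" if "y \<in> M" for y
    using dle[OF that] by (meson norm_ge_zero order_trans power2_le_imp_le)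
  thus ?thesis using lM by blast
qed

lemma orthogonal_decomposition:
  fixes M :: "'a::complex_hilbert set"
  assumes M: "complex_vector.subspace M" and cl: "closed M"
  shows "\<exists>m\<in>M. \<forall>y\<in>M. cinner (x - m) y = 0"
proof -
  obtain m where m: "m \<in> M" "\<And>y. y \<in> M \<Longrightarrow> norm (x - m) \<le> norm (x - y)"
    using nearest_point_exists[OF assms, of x] by blast
  have "cinner (x - m) y = 0" if y: "y \<in> M" for y
  proof (cases "y = 0")
    case False
    \<comment> \<open>The coefficient of the projection of \<open>x - m\<close> onto y: moving m by
      c y would lower the squared distance by |c|^2 |y|^2.\<close>
    define c where "c = cinner (x - m) y / (norm y)\<^sup>2"
    have "m + c *\<^sub>C y \<in> M"
      by (intro complex_vector.subspace_add[OF M] complex_vector.subspace_scale[OF M] m y)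
    from m(2)[OF this] have "(norm (x - m))\<^sup>2 \<le> (norm ((x - m) - c *\<^sub>C y))\<^sup>2"
      by (simp add: diff_diff_eq power_mono)
    hence "2 * Re (cinner (x - m) (c *\<^sub>C y)) \<le> (norm (c *\<^sub>C y))\<^sup>2"
      unfolding norm_diff_sq by linarith
    moreover have "cinner (x - m) (c *\<^sub>C y) = complex_of_real ((cmod c)\<^sup>2 * (norm y)\<^sup>2)"
    proof -
      have "cinner (x - m) y = c * complex_of_real ((norm y)\<^sup>2)" using False by (simp add: c_def)
      thus ?thesis
        unfolding cinner_scaleC_right of_real_mult complex_norm_square by (simp add: mult_ac)
    qed
    ultimately have "(cmod c)\<^sup>2 * (norm y)\<^sup>2 \<le> 0"
      by (simp add: norm_scaleC power_mult_distrib mult.commute del: of_real_mult of_real_power)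
    hence "c = 0" using False by (auto simp: mult_le_0_iff)
    thus ?thesis using False by (simp add: c_def)
  qed simp
  thus ?thesis using m(1) by blast
qed

lemma riesz_representation:
  fixes f :: "'a::complex_hilbert \<Rightarrow> complex"
  assumes f: "bounded_clinear f"
  shows "\<exists>z. \<forall>x. f x = cinner x z"
proof (cases "\<forall>x. f x = 0")
  case True
  thus ?thesis by (intro exI[of _ 0]) simp
next
  case False
  then obtain x0 where x0: "f x0 \<noteq> 0" by blast
  interpret f: bounded_linear f using f by (rule bounded_clinear_bounded_linear)
  have fC: "f (c *\<^sub>C x) = c * f x" for c x
    using f by (simp add: bounded_clinear_def scaleC_complex_def)
  define M where "M = {x. f x = 0}"
  have "complex_vector.subspace M"
    by (rule complex_vector.subspaceI) (auto simp: M_def f.add fC f.zero)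
  moreover have "closed M"
    unfolding M_def by (intro closed_Collect_eq f.continuous_on continuous_intros)
  ultimately obtain m where m: "m \<in> M" "\<And>y. y \<in> M \<Longrightarrow> cinner (x0 - m) y = 0"
    using orthogonal_decomposition[of M x0] by blast
  define n where "n = x0 - m"
  have fn: "f n \<noteq> 0" using x0 m(1) by (simp add: n_def f.diff M_def)
  hence n0: "n \<noteq> 0" using f.zero by auto
  \<comment> \<open>The vector n is normal to the kernel of f, and subtracting (f x / f n) n from x
    lands in that kernel. Hence <x, n> = (f x / f n) |n|^2, which dictates the scaling of n.\<close>
  define z where "z = (cnj (f n) / (norm n)\<^sup>2) *\<^sub>C n"
  have "f x = cinner x z" for x
  proof -
    have "x - (f x / f n) *\<^sub>C n \<in> M" using fn by (simp add: M_def f.diff fC)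
    hence "cinner n (x - (f x / f n) *\<^sub>C n) = 0" using m(2) by (simp add: n_def)
    hence "cinner (x - (f x / f n) *\<^sub>C n) n = 0"
      by (subst cinner_commute) simp
    hence "cinner x n = f x / f n * (norm n)\<^sup>2" by (simp add: cinner_simps cinner_self)
    thus ?thesis using fn n0 by (simp add: z_def cinner_simps)
  qed
  thus ?thesis by blast
qed

section \<open>Adjoints of bounded operators\<close>

lemma cinner_eqI_dense:
  assumes "closure D = UNIV" and "\<And>x. x \<in> D \<Longrightarrow> cinner x y = cinner x (z::'a::complex_inner)"
  shows "y = z"
proof -
  have cl: "closed {x. cinner x (y - z) = 0}"
    by (intro closed_Collect_eq continuous_intros
      linear_continuous_on bounded_bilinear.bounded_linear_left[OF bounded_bilinear_cinner])
  have "D \<subseteq> {x. cinner x (y - z) = 0}" using assms(2) by (auto simp: cinner_simps)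
  from closure_minimal[OF this cl] have "y - z \<in> {x. cinner x (y - z) = 0}"
    using assms(1) by blast
  thus ?thesis by (simp add: cinner_self)
qed

lemma adj_eqI:
  assumes "closure D = UNIV" and "\<And>x. x \<in> D \<Longrightarrow> cinner (A x) y = cinner x z"
  shows "adj D A y = z"
  unfolding adj_def
  by (rule the_equality) (use assms in \<open>auto intro!: cinner_eqI_dense[OF assms(1)]\<close>)

lemma cinner_adj:
  fixes T :: "'a::complex_hilbert \<Rightarrow> 'b::complex_inner"
  assumes "bounded_clinear T"
  shows "cinner (T x) y = cinner x (adj UNIV T y)"
proof -
  interpret bounded_linear T using assms by (rule bounded_clinear_bounded_linear)
  obtain K where K: "\<And>x. norm (T x) \<le> norm x * K" using bounded by blast
  have "bounded_clinear (\<lambda>x. cinner (T x) y)"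
  proof (rule bounded_clinearI[where C = "K * norm y"])
    show "norm (cinner (T x) y) \<le> K * norm y * norm x" for x
      using cmod_cinner_le[of "T x" y] mult_right_mono[OF K[of x], of "norm y"]
      by (simp add: mult_ac)
  qed (simp_all add: add cinner_simps bounded_clinear_scaleC[OF assms] scaleC_complex_def)
  from riesz_representation[OF this] obtain z where "\<And>x. cinner (T x) y = cinner x z" by blast
  moreover from this have "adj UNIV T y = z" by (intro adj_eqI) auto
  ultimately show ?thesis by simp
qed

lemma adj_add:
  fixes T :: "'a::complex_hilbert \<Rightarrow> 'b::complex_inner"
  assumes "bounded_clinear T"
  shows "adj UNIV T (x + y) = adj UNIV T x + adj UNIV T y"
  by (rule adj_eqI) (simp_all add: cinner_adj[OF assms] cinner_simps)

lemma adj_scaleC: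
  fixes T :: "'a::complex_hilbert \<Rightarrow> 'b::complex_inner"
  assumes "bounded_clinear T"
  shows "adj UNIV T (c *\<^sub>C x) = c *\<^sub>C adj UNIV T x"
  by (rule adj_eqI) (simp_all add: cinner_adj[OF assms] cinner_simps)

section \<open>The Baire category theorem and its consequences\<close>

lemma Baire_closed_cover:
  fixes F :: "nat \<Rightarrow> 'a::complete_space set"
  assumes "\<And>n. closed (F n)" and "(\<Union>n. F n) = UNIV"
  shows "\<exists>n. interior (F n) \<noteq> {}"
proof (rule ccontr)
  assume "\<not> ?thesis"
  hence "Met_TC.mtopology interior_of \<Union>(range F) = {}"
    by (intro Met_TC.metric_Baire_category_alt)
      (use assms in \<open>auto simp: mcomplete_iff_complete complete_UNIV\<close>)
  thus False using assms by simp
qed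

text \<open>Zabreiko's lemma; the closed graph theorem and the uniform boundedness principle are both
  special cases.\<close>

lemma countably_subadditive_bounded:
  fixes p :: "'a::banach \<Rightarrow> real"
  assumes nonneg: "\<And>x. 0 \<le> p x"
    and scale: "\<And>r x. p (r *\<^sub>R x) = \<bar>r\<bar> * p x"
    and add: "\<And>x y. p (x + y) \<le> p x + p y"
    and sub: "\<And>u. summable (\<lambda>n. norm (u n)) \<Longrightarrow> summable (\<lambda>n. p (u n)) \<Longrightarrow>
      p (suminf u) \<le> (\<Sum>n. p (u n))"
  shows "\<exists>C. \<forall>x. p x \<le> C * norm x"
proof -
  define F where "F = (\<lambda>n::nat. closure {x. p x \<le> real n})"
  have "\<exists>n. x \<in> F n" for x
  proof -
    obtain n where "p x \<le> real n" using real_arch_simple by blast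
    thus ?thesis unfolding F_def by (intro exI[of _ n] subsetD[OF closure_subset]) simp
  qed
  hence "\<exists>n. interior (F n) \<noteq> {}"
    by (intro Baire_closed_cover) (auto simp: F_def)
  then obtain n a where "a \<in> interior (F n)" by blast
  then obtain r where r: "r > 0" "ball a r \<subseteq> F n"
    using mem_interior by blast
  \<comment> \<open>The ball has an unknown centre \<open>a\<close>. Approximating both
    \<open>a + x\<close> and \<open>a - x\<close> and halving the difference of the approximants
    moves it to the origin.\<close>
  have approx0: "\<exists>y. p y \<le> n \<and> norm (x - y) < e" if x: "norm x < r" and e: "e > 0" for x e
  proof -
    have near: "\<exists>y. p y \<le> n \<and> dist y v < e" if "v \<in> ball a r" for v
    proof -
      have "v \<in> closure {x. p x \<le> real n}" using that r(2) by (auto simp: F_def)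
      thus ?thesis using e closure_approachable[of v "{x. p x \<le> real n}"] by auto
    qed
    obtain y1 where y1: "p y1 \<le> n" "dist y1 (a + x) < e"
      using near[of "a + x"] x by (auto simp: dist_norm)
    obtain y2 where y2: "p y2 \<le> n" "dist y2 (a - x) < e"
      using near[of "a - x"] x by (auto simp: dist_norm)
    define y where "y = (1/2) *\<^sub>R (y1 + (- 1) *\<^sub>R y2)"
    have "p y = 1/2 * p (y1 + (- 1) *\<^sub>R y2)" unfolding y_def scale by simp
    also have "\<dots> \<le> 1/2 * (p y1 + p ((- 1) *\<^sub>R y2))"
      using add[of y1 "(- 1) *\<^sub>R y2"] by simp
    also have "\<dots> \<le> n" using y1 y2 scale[of "-1" y2] by simp
    finally have "p y \<le> n" .
    moreover have "2 *\<^sub>R (x - y) = ((a + x) - y1) - ((a - x) - y2)"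
      by (simp add: y_def scaleR_right_diff_distrib) (simp add: scaleR_2)
    hence "2 * norm (x - y) = norm (((a + x) - y1) - ((a - x) - y2))"
      by (metis abs_numeral norm_scaleR)
    hence "2 * norm (x - y) \<le> norm ((a + x) - y1) + norm ((a - x) - y2)"
      using norm_triangle_ineq4[of "(a + x) - y1" "(a - x) - y2"] by simp
    hence "norm (x - y) < e" using y1 y2 by (simp add: dist_norm norm_minus_commute)
    ultimately show ?thesis by blast
  qed
  \<comment> \<open>By homogeneity the approximation works at every scale; the error r/2 makes the
    remainder fit the next scale.\<close>
  have "\<exists>y. p y \<le> n / 2^k \<and> norm (x - y) < r / 2^Suc k" if x: "norm x < r / 2^k" for x k
  proof -
    have "norm ((2^k) *\<^sub>R x) < r" using x by (simp add: field_simps)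
    from approx0[OF this, of "r/2"] r obtain y where y: "p y \<le> n" "norm ((2^k) *\<^sub>R x - y) < r/2"
      by auto
    have "x - (1/2^k) *\<^sub>R y = (1/2^k) *\<^sub>R ((2^k) *\<^sub>R x - y)" by (simp add: algebra_simps)
    hence "norm (x - (1/2^k) *\<^sub>R y) = (1/2^k) * norm ((2^k) *\<^sub>R x - y)" by simp
    also have "\<dots> < (1/2^k) * (r/2)" using y by (intro mult_strict_left_mono) auto
    finally show ?thesis using y
      by (intro exI[of _ "(1/2^k) *\<^sub>R y"]) (auto simp: scale divide_simps)
  qed
  note step = someI_ex[OF this]
  define g where "g k x = (SOME y. p y \<le> n / 2^k \<and> norm (x - y) < r / 2^Suc k)" for k :: nat and x
  have g: "p (g k x) \<le> n / 2^k" "norm (x - g k x) < r / 2^Suc k" if "norm x < r / 2^k" for k x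
    using step[OF that] by (auto simp: g_def)
  have bound: "p x \<le> 2 * n" if x: "norm x < r" for x
  proof -
    \<comment> \<open>The remainders of successive approximation: their differences
      \<open>u k\<close> add up to x, with geometrically decaying \<open>p (u k)\<close>.\<close>
    define s where "s = rec_nat x (\<lambda>k y. y - g k y)"
    have s0: "s 0 = x" and sS: "\<And>k. s (Suc k) = s k - g k (s k)" by (simp_all add: s_def)
    have sn: "norm (s k) < r / 2^k" for k
    proof (induction k)
      case 0 thus ?case using x by (simp add: s0)
    next
      case (Suc k) thus ?case using g(2)[OF Suc] by (simp add: sS)
    qed
    define u where "u = (\<lambda>k. g k (s k))"
    have geo: "(\<lambda>k. c / 2^k) sums (2 * c)" for c :: real
      using sums_mult[OF geometric_sums[of "1/2::real"], of c] by (simp add: field_simps)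
    have s_lim: "s \<longlonglongrightarrow> 0"
    proof (rule Lim_null_comparison)
      show "\<forall>\<^sub>F k in sequentially. norm (s k) \<le> r / 2^k"
        using sn less_imp_le by (intro always_eventually) blast
      show "(\<lambda>k. r / 2^k) \<longlonglongrightarrow> 0"
        using geo sums_summable summable_LIMSEQ_zero by blast
    qed
    have "(\<lambda>k. s k - s (Suc k)) sums (s 0 - 0)" by (rule telescope_sums'[OF s_lim])
    hence u_sums: "u sums x" by (simp add: sS s0 u_def)
    have pu: "p (u k) \<le> n / 2^k" for k unfolding u_def using g(1) sn by blast
    have nu: "norm (u k) \<le> (2 * r) / 2^k" for k
    proof -
      have "norm (u k) \<le> norm (s k) + norm (s (Suc k))"
        using norm_triangle_ineq4[of "s k" "s (Suc k)"] by (simp add: sS u_def)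
      also have "\<dots> \<le> r / 2^k + r / 2^k" using sn[of k] sn[of "Suc k"] r by (simp add: field_simps)
      finally show ?thesis by simp
    qed
    have sum_p: "summable (\<lambda>k. p (u k))"
      by (rule summable_comparison_test'[OF sums_summable[OF geo[of n]], of 0])
        (use pu nonneg in auto)
    have "summable (\<lambda>k. norm (u k))"
      by (rule summable_comparison_test'[OF sums_summable[OF geo[of "2 * r"]], of 0])
        (use nu in auto)
    from sub[OF this sum_p] have "p x \<le> (\<Sum>k. p (u k))" using u_sums by (simp add: sums_iff)
    also have "\<dots> \<le> (\<Sum>k. n / 2^k)"
      by (intro suminf_le pu sum_p sums_summable[OF geo])
    also have "\<dots> = 2 * n" using geo[of n] by (simp add: sums_iff)
    finally show ?thesis .
  qed
  have "p x \<le> (4 * n / r) * norm x" for x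
  proof (cases "x = 0")
    case True thus ?thesis using scale[of 0 x] by simp
  next
    case False
    have "norm ((r / (2 * norm x)) *\<^sub>R x) < r" using False r by simp
    from bound[OF this] have "r / (2 * norm x) * p x \<le> 2 * n" using r by (simp add: scale)
    thus ?thesis using False r by (simp add: field_simps)
  qed
  thus ?thesis by blast
qed

text \<open>Here p is the norm of T x. Closedness of the graph identifies the image of a convergent
  series with the series of the images, which is countable subadditivity.\<close>

lemma closed_graph_bounded_linear:
  fixes T :: "'a::banach \<Rightarrow> 'b::banach"
  assumes T: "linear T" and cl: "closed {(x, T x) |x. True}"
  shows "bounded_linear T"
proof -
  have "\<exists>C. \<forall>x. norm (T x) \<le> C * norm x"
  proof (rule countably_subadditive_bounded)
    fix u :: "nat \<Rightarrow> 'a"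
    assume u: "summable (\<lambda>n. norm (u n))" "summable (\<lambda>n. norm (T (u n)))"
    have "(\<lambda>n. \<Sum>i<n. T (u i)) \<longlonglongrightarrow> suminf (\<lambda>n. T (u n))"
      by (rule summable_LIMSEQ[OF summable_norm_cancel[OF u(2)]])
    moreover have "(\<lambda>n. \<Sum>i<n. u i) \<longlonglongrightarrow> suminf u"
      by (rule summable_LIMSEQ[OF summable_norm_cancel[OF u(1)]])
    ultimately have "(\<lambda>n. (\<Sum>i<n. u i, T (\<Sum>i<n. u i))) \<longlonglongrightarrow> (suminf u, suminf (\<lambda>n. T (u n)))"
      by (simp add: linear_sum[OF T] tendsto_Pair)
    hence "(suminf u, suminf (\<lambda>n. T (u n))) \<in> {(x, T x) |x. True}"
      by (rule closed_sequentially[OF cl, rotated]) blast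
    hence "T (suminf u) = suminf (\<lambda>n. T (u n))" by simp
    thus "norm (T (suminf u)) \<le> (\<Sum>n. norm (T (u n)))" using summable_norm[OF u(2)] by simp
  qed (simp_all add: linear_scale[OF T] linear_add[OF T] norm_triangle_ineq)
  then obtain C where "\<And>x. norm (T x) \<le> C * norm x" by blast
  thus ?thesis
    by (intro bounded_linear_intro[where K = C])
      (simp_all add: linear_scale[OF T] linear_add[OF T] mult.commute)
qed

text \<open>The supremum of countably subadditive seminorms is again countably subadditive;
  pointwise boundedness makes it finite.\<close>

lemma uniform_boundedness:
  fixes f :: "nat \<Rightarrow> 'a::banach \<Rightarrow> 'b::banach"
  assumes f: "\<And>n. bounded_linear (f n)" and bdd: "\<And>x. \<exists>b. \<forall>n. norm (f n x) \<le> b"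
  shows "\<exists>C. \<forall>n x. norm (f n x) \<le> C * norm x"
proof -
  define p where "p x = (SUP n. norm (f n x))" for x
  have bdd: "bdd_above (range (\<lambda>n. norm (f n x)))" for x
    using bdd[of x] by (auto intro: bdd_aboveI2)
  have le: "norm (f n x) \<le> p x" for n x
    unfolding p_def by (rule cSUP_upper[OF _ bdd]) simp
  have p_leI: "p x \<le> c" if "\<And>n. norm (f n x) \<le> c" for x c
    unfolding p_def by (rule cSUP_least) (use that in auto)
  have nonneg: "0 \<le> p x" for x using le[of 0 x] norm_ge_zero order_trans by blast
  have "\<exists>C. \<forall>x. p x \<le> C * norm x"
  proof (rule countably_subadditive_bounded)
    fix r x
    show "p (r *\<^sub>R x) = \<bar>r\<bar> * p x"
    proof (rule antisym)
      show up: "p (r *\<^sub>R x) \<le> \<bar>r\<bar> * p x" for r x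
        by (rule p_leI) (simp add: linear_simps[OF f] mult_left_mono[OF le])
      show "\<bar>r\<bar> * p x \<le> p (r *\<^sub>R x)"
      proof (cases "r = 0")
        case False
        show ?thesis using up[of "inverse r" "r *\<^sub>R x"] False by (simp add: field_simps)
      qed (simp add: nonneg)
    qed
  next
    fix x y show "p (x + y) \<le> p x + p y"
    proof (rule p_leI)
      fix n
      show "norm (f n (x + y)) \<le> p x + p y"
        using norm_triangle_ineq[of "f n x" "f n y"] le[of n x] le[of n y]
        by (simp add: linear_simps[OF f])
    qed
  next
    fix u :: "nat \<Rightarrow> 'a"
    assume u: "summable (\<lambda>n. norm (u n))" "summable (\<lambda>n. p (u n))"
    show "p (suminf u) \<le> (\<Sum>n. p (u n))"
    proof (rule p_leI)
      fix m
      have s: "summable (\<lambda>n. norm (f m (u n)))"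
        by (rule summable_comparison_test'[OF u(2), of 0]) (use le in auto)
      have "f m (suminf u) = (\<Sum>n. f m (u n))"
        by (rule bounded_linear.suminf[OF f summable_norm_cancel[OF u(1)]])
      also have "norm \<dots> \<le> (\<Sum>n. norm (f m (u n)))"
        by (rule summable_norm[OF s])
      also have "\<dots> \<le> (\<Sum>n. p (u n))" by (intro suminf_le le s u)
      finally show "norm (f m (suminf u)) \<le> (\<Sum>n. p (u n))" .
    qed
  qed (rule nonneg)
  then obtain C where "\<And>x. p x \<le> C * norm x" by blast
  with le show ?thesis by (meson order_trans)
qed

section \<open>Operators with dissipative inverse\<close>

lemma inverse_dissipative_adjoint:
  fixes Q K :: "'a::complex_inner \<Rightarrow> 'a"
  assumes adj: "\<And>x y. cinner (Q x) y = cinner x (K y)" and w: "w > 0"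
    and diss: "\<And>x. Re (cinner x (K x)) \<le> - w * (norm (K x))\<^sup>2"
  shows "Re (cinner x (Q x)) \<le> - w * (norm (Q x))\<^sup>2"
proof -
  \<comment> \<open>The hypothesis says that \<open>1 + 2 w K\<close> is a contraction, and so is its adjoint \<open>1 + 2 w Q\<close>.\<close>
  have expand: "(norm (x + (2 * w) *\<^sub>R y))\<^sup>2 =
      (norm x)\<^sup>2 + 4 * w * (Re (cinner x y) + w * (norm y)\<^sup>2)" for x y :: 'a
    by (simp add: norm_add_sq cinner_simps power_mult_distrib) (simp add: power2_eq_square algebra_simps)
  have K: "norm (y + (2 * w) *\<^sub>R K y) \<le> norm y" for y
  proof (rule power2_le_imp_le)
    show "(norm (y + (2 * w) *\<^sub>R K y))\<^sup>2 \<le> (norm y)\<^sup>2"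
      using diss[of y] w unfolding expand by (simp add: mult_le_0_iff)
  qed simp
  define v where "v = x + (2 * w) *\<^sub>R Q x"
  have "cinner v v = cinner x (v + (2 * w) *\<^sub>R K v)"
    by (subst v_def) (simp add: cinner_simps adj)
  hence "(norm v)\<^sup>2 = Re (cinner x (v + (2 * w) *\<^sub>R K v))"
    by (metis Re_cinner_self)
  also have "\<dots> \<le> norm x * norm (v + (2 * w) *\<^sub>R K v)" by (rule Re_cinner_le_norm)
  also have "\<dots> \<le> norm x * norm v" by (rule mult_left_mono[OF K]) simp
  finally have "norm v \<le> norm x"
    by (cases "norm v = 0") (auto simp: power2_eq_square)
  hence "(norm v)\<^sup>2 \<le> (norm x)\<^sup>2" by (simp add: power_mono)
  hence "4 * w * (Re (cinner x (Q x)) + w * (norm (Q x))\<^sup>2) \<le> 0"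
    unfolding v_def expand by simp
  thus ?thesis using w by (simp add: mult_le_0_iff)
qed

text \<open>For a pair u = Q x, A u = x the inequality reads Re <A u, u> <= - w |u|^2. Stating it
  through Q leaves room for a kernel, on which no such A is single-valued.\<close>

locale inverse_dissipative =
  fixes Q :: "'a::complex_hilbert \<Rightarrow> 'a" and w :: real
  assumes add: "Q (x + y) = Q x + Q y"
    and scaleC: "Q (c *\<^sub>C x) = c *\<^sub>C Q x"
    and w_pos: "w > 0"
    and diss: "Re (cinner x (Q x)) \<le> - w * (norm (Q x))\<^sup>2"
begin

text \<open>Adding l |Q x|^2 to the dissipativity inequality gives (l + w) |Q x|^2 <= - Re <x - l Q
  x, Q x>, and Cauchy-Schwarz removes one factor. The case l = 0 bounds Q by 1/w.\<close>

lemma shift_bound: "(l + w) * norm (Q x) \<le> norm (x - l *\<^sub>R Q x)"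
proof (cases "Q x = 0")
  case False
  have "(l + w) * (norm (Q x))\<^sup>2 \<le> - Re (cinner (x - l *\<^sub>R Q x) (Q x))"
    using diss[of x] by (simp add: cinner_simps Re_cinner_self algebra_simps)
  also have "\<dots> \<le> norm (x - l *\<^sub>R Q x) * norm (Q x)"
    using Re_cinner_le_norm[of "- (x - l *\<^sub>R Q x)" "Q x"]
    unfolding cinner_minus_left norm_minus_cancel by simp
  finally show ?thesis using False by (simp add: power2_eq_square mult.assoc[symmetric])
qed simp

lemma bounded_clinear: "bounded_clinear Q"
proof (rule bounded_clinearI[where C = "inverse w"])
  show "norm (Q x) \<le> inverse w * norm x" for x
    using shift_bound[of 0 x] w_pos by (simp add: field_simps)
qed (fact add scaleC)+

lemma bounded_linear: "bounded_linear Q"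
  by (rule bounded_clinear_bounded_linear[OF bounded_clinear])

lemmas Q_simps = linear_simps[OF bounded_linear]

lemma shift_inj:
  assumes "l > - w" and "x - l *\<^sub>R Q x = y - l *\<^sub>R Q y"
  shows "x = y"
proof -
  have 0: "(x - y) - l *\<^sub>R Q (x - y) = 0"
    using assms(2) by (simp add: Q_simps algebra_simps)
  hence "(l + w) * norm (Q (x - y)) \<le> 0" using shift_bound[of l "x - y"] by simp
  hence "Q (x - y) = 0" using assms(1) by (auto simp: mult_le_0_iff)
  thus ?thesis using 0 by simp
qed

text \<open>Continuation in \<open>l\<close>: at a parameter \<open>l\<close> where the equation is solvable, \<open>x - m Q x = y\<close> is a
  fixed point problem with contraction constant \<open>\<bar>m - l\<bar> / (l + w)\<close>.\<close>

lemma shift_surj_step: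
  assumes l: "l > - w" and surj: "\<And>y. \<exists>x. x - l *\<^sub>R Q x = y" and m: "\<bar>m - l\<bar> < l + w"
  shows "\<exists>x. x - m *\<^sub>R Q x = y"
proof -
  obtain J where J: "\<And>y. J y - l *\<^sub>R Q (J y) = y" using surj by metis
  \<comment> \<open>With u = x - l Q x, that is x = J u, the equation x - m Q x = y becomes u = f
    u.\<close>
  define f where "f u = y + (m - l) *\<^sub>R Q (J u)" for u
  have "dist (f u) (f v) \<le> (\<bar>m - l\<bar> / (l + w)) * dist u v" for u v
  proof -
    have "(J u - J v) - l *\<^sub>R Q (J u - J v) = (J u - l *\<^sub>R Q (J u)) - (J v - l *\<^sub>R Q (J v))"
      by (simp add: Q_simps algebra_simps)
    hence "(J u - J v) - l *\<^sub>R Q (J u - J v) = u - v" unfolding J .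
    hence "(l + w) * norm (Q (J u - J v)) \<le> norm (u - v)"
      using shift_bound[of l "J u - J v"] by simp
    hence "\<bar>m - l\<bar> * ((l + w) * norm (Q (J u - J v))) \<le> \<bar>m - l\<bar> * norm (u - v)"
      by (rule mult_left_mono) simp
    moreover have "f u - f v = (m - l) *\<^sub>R Q (J u - J v)"
      by (simp add: f_def Q_simps scaleR_diff_right)
    hence "norm (f u - f v) = \<bar>m - l\<bar> * norm (Q (J u - J v))" by simp
    ultimately have "(l + w) * norm (f u - f v) \<le> \<bar>m - l\<bar> * norm (u - v)"
      by (simp only: mult.left_commute)
    thus ?thesis using l by (simp add: dist_norm pos_le_divide_eq mult.commute)
  qed
  hence "\<exists>!u. f u = u"
    using l m by (intro banach_fix_type[of "\<bar>m - l\<bar> / (l + w)"]) (auto simp: divide_simps)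
  then obtain u where "f u = u" by blast
  hence "J u - m *\<^sub>R Q (J u) = y" using J[of u] by (simp add: f_def algebra_simps)
  thus ?thesis by blast
qed

text \<open>A parameter l >= 0 has continuation radius at least w, so finitely many steps of length
  w/2 reach any positive value; a negative value above -w is within the radius at 0.\<close>

lemma shift_surj:
  assumes "l > - w"
  shows "\<exists>x. x - l *\<^sub>R Q x = y"
proof -
  have pos: "\<exists>x. x - l *\<^sub>R Q x = y" if "0 \<le> l" "l \<le> real n * (w / 2)" for n l y
    using that
  proof (induction n arbitrary: l y)
    case 0
    thus ?case by simp
  next
    case (Suc n)
    show ?case
    proof (rule shift_surj_step[of "max 0 (l - w / 2)"])
      show "\<exists>x. x - max 0 (l - w / 2) *\<^sub>R Q x = y" for y
        using Suc.prems by (intro Suc.IH) (auto simp: max_def algebra_simps)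
    qed (use w_pos Suc.prems in \<open>auto simp: max_def\<close>)
  qed
  show ?thesis
  proof (cases "0 \<le> l")
    case True
    obtain n where "l / (w / 2) \<le> real n" using real_arch_simple by blast
    thus ?thesis using w_pos True by (intro pos[of l n]) (auto simp: field_simps)
  next
    case False
    show ?thesis by (rule shift_surj_step[of 0]) (use False assms w_pos in auto)
  qed
qed

lemma shift_bij: "l > - w \<Longrightarrow> bij (\<lambda>x. x - l *\<^sub>R Q x)"
  unfolding bij_def inj_on_def surj_def by (metis shift_inj shift_surj)

end

section \<open>Linear evolution equations\<close>

text \<open>The solution is the exponential series of t G applied to x. Summing vectors rather than
  operators keeps the partial sums in V, and closedness keeps the limit there.\<close>

lemma linear_ode_solution_exists:
  fixes G :: "'a::banach \<Rightarrow> 'a"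
  assumes G: "bounded_linear G" and cl: "closed V" and V0: "0 \<in> V"
    and Vadd: "\<And>x y. x \<in> V \<Longrightarrow> y \<in> V \<Longrightarrow> x + y \<in> V"
    and Vscale: "\<And>r x. x \<in> V \<Longrightarrow> r *\<^sub>R x \<in> V"
    and VG: "\<And>x. x \<in> V \<Longrightarrow> G x \<in> V" and x: "x \<in> V"
  shows "\<exists>u. u 0 = x \<and> (\<forall>t. (u has_vector_derivative G (u t)) (at t)) \<and> (\<forall>t. u t \<in> V)"
proof -
  interpret G: bounded_linear G by (rule G)
  obtain K where K: "\<And>x. norm (G x) \<le> norm x * K" "K > 0"
    using G.pos_bounded by blast
  define a where "a n = (G ^^ n) x" for n
  have aS: "a (Suc n) = G (a n)" for n by (simp add: a_def)
  have aV: "a n \<in> V" for n by (induction n) (simp_all add: aS VG, simp add: a_def x)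
  have na: "norm (a n) \<le> norm x * K ^ n" for n
  proof (induction n)
    case (Suc n)
    have "norm (a (Suc n)) \<le> norm (a n) * K" unfolding aS by (rule K)
    also have "\<dots> \<le> norm x * K ^ n * K" using Suc K(2) by (intro mult_right_mono) auto
    finally show ?case by (simp add: mult_ac)
  qed (simp add: a_def)
  define f where "f n t = (t ^ n / fact n) *\<^sub>R a n" for n and t :: real
  \<comment> \<open>Differentiating a term gives G of the preceding term, so the differentiated
    series starts with 0 and sums to \<open>G (u t)\<close>.\<close>
  define f' where "f' n t = (case n of 0 \<Rightarrow> 0 | Suc k \<Rightarrow> G (f k t))" for n t
  define M where "M R n = norm x * (inverse (fact n) * (R * K) ^ n)" for R :: real and n
  have M: "summable (M R)" for R unfolding M_def by (intro summable_mult summable_exp)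
  have fM: "norm (f n t) \<le> M R n" if "\<bar>t\<bar> \<le> R" for R n t
  proof -
    have "norm (f n t) = \<bar>t\<bar> ^ n / fact n * norm (a n)" by (simp add: f_def power_abs)
    also have "\<dots> \<le> R ^ n / fact n * (norm x * K ^ n)"
      using that by (intro mult_mono divide_right_mono power_mono na) auto
    also have "\<dots> = M R n" by (simp add: M_def power_mult_distrib divide_inverse mult_ac)
    finally show ?thesis .
  qed
  have sf: "summable (\<lambda>n. f n t)" for t
    by (rule summable_comparison_test'[OF M[of "\<bar>t\<bar>"], of 0]) (use fM in auto)
  define u where "u t = (\<Sum>n. f n t)" for t
  have f'_sum: "(\<Sum>n. f' n t) = G (u t)" for t
  proof -
    have s: "summable (\<lambda>n. G (f n t))" by (rule G.summable[OF sf])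
    hence "summable (\<lambda>n. f' n t)"
      by (subst summable_Suc_iff[symmetric]) (simp add: f'_def)
    from suminf_split_head[OF this] have "(\<Sum>n. f' n t) = (\<Sum>n. G (f n t))"
      by (simp add: f'_def)
    also have "\<dots> = G (u t)" unfolding u_def by (rule G.suminf[OF sf, symmetric])
    finally show ?thesis .
  qed
  have deriv: "(u has_vector_derivative G (u t)) (at t)" for t
  proof -
    define R where "R = \<bar>t\<bar> + 1"
    \<comment> \<open>The Weierstrass majorants are uniform only on bounded intervals, so the series
      is differentiated termwise near each t separately.\<close>
    define S where "S = {- R<..<R}"
    have tS: "t \<in> S" and oS: "open S" and cS: "convex S" by (auto simp: S_def R_def)
    have ulim: "uniform_limit S (\<lambda>n s. \<Sum>i<n. f' i s) (\<lambda>s. \<Sum>i. f' i s) sequentially"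
    proof (rule Weierstrass_m_test)
      show "summable (\<lambda>n. case n of 0 \<Rightarrow> 0 | Suc k \<Rightarrow> M R k * K)"
        by (subst summable_Suc_iff[symmetric]) (simp add: summable_mult2[OF M])
      show "norm (f' n s) \<le> (case n of 0 \<Rightarrow> 0 | Suc k \<Rightarrow> M R k * K)" if "s \<in> S" for n s
      proof (cases n)
        case (Suc k)
        have "norm (G (f k s)) \<le> norm (f k s) * K" by (rule K)
        also have "\<dots> \<le> M R k * K"
          using that K(2) by (intro mult_right_mono fM) (auto simp: S_def)
        finally show ?thesis by (simp add: Suc f'_def)
      qed (simp add: f'_def)
    qed
    have "\<exists>g. \<forall>s\<in>S. (\<lambda>n. f n s) sums g s \<and> (g has_derivative (\<lambda>h. h *\<^sub>R G (u s))) (at s within S)"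
    proof (rule has_derivative_series[OF cS _ _ tS summable_sums[OF sf]])
      fix n s assume "s \<in> S"
      have "(f n has_vector_derivative f' n s) (at s within S)"
      proof (cases n)
        case 0 thus ?thesis by (simp add: f_def[abs_def] f'_def)
      next
        case (Suc k)
        have "((\<lambda>t. t ^ n / fact n) has_field_derivative (s ^ k / fact k)) (at s within S)"
          unfolding Suc by (rule derivative_eq_intros refl | simp)+
        from has_vector_derivative_scaleR[OF this has_vector_derivative_const[of "a n"]]
        show ?thesis by (simp add: f_def[abs_def] f'_def Suc aS G.scaleR)
      qed
      thus "(f n has_derivative (\<lambda>h. h *\<^sub>R f' n s)) (at s within S)"
        by (simp add: has_vector_derivative_def)
    next
      fix e :: real assume "e > 0"
      from uniform_limitD[OF ulim this]
      show "\<forall>\<^sub>F n in sequentially. \<forall>s\<in>S. \<forall>h. norm ((\<Sum>i<n. h *\<^sub>R f' i s) - h *\<^sub>R G (u s)) \<le> e * norm h"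
      proof eventually_elim
        case (elim n)
        have "norm (h *\<^sub>R ((\<Sum>i<n. f' i s) - G (u s))) \<le> e * norm h" if "s \<in> S" for s h
        proof -
          have "norm ((\<Sum>i<n. f' i s) - G (u s)) \<le> e"
            using elim that by (force simp: f'_sum dist_norm)
          thus ?thesis by (simp add: mult.commute[of e] mult_left_mono)
        qed
        thus ?case by (simp add: scaleR_diff_right scaleR_sum_right)
      qed
    qed
    then obtain g where g: "\<And>s. s \<in> S \<Longrightarrow> (\<lambda>n. f n s) sums g s"
        "\<And>s. s \<in> S \<Longrightarrow> (g has_vector_derivative G (u s)) (at s within S)"
      by (auto simp: has_vector_derivative_def)
    have "u s = g s" if "s \<in> S" for s using g(1)[OF that] by (simp add: u_def sums_iff)
    from has_vector_derivative_transform[OF tS this g(2)[OF tS]]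
    have "(u has_vector_derivative G (u t)) (at t within S)" by simp
    thus ?thesis by (subst (asm) has_vector_derivative_within_open[OF tS oS])
  qed
  have "u 0 = x"
  proof -
    have "(\<Sum>n. f n 0) = (\<Sum>n\<in>{0}. f n 0)" by (rule suminf_finite) (auto simp: f_def)
    thus ?thesis by (simp add: u_def f_def a_def)
  qed
  moreover have "u t \<in> V" for t
  proof -
    have "(\<Sum>i<n. f i t) \<in> V" for n
      by (induction n) (auto simp: V0 f_def intro!: Vadd Vscale aV)
    thus ?thesis
      by (rule closed_sequentially[OF cl _ summable_LIMSEQ[OF sf], folded u_def])
  qed
  ultimately show ?thesis using deriv by blast
qed

section \<open>Energy estimates on the half-line\<close>

lemma norm_sq_has_derivative:
  fixes u :: "real \<Rightarrow> 'a::complex_inner"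
  assumes "(u has_vector_derivative u') (at t within S)"
  shows "((\<lambda>t. (norm (u t))\<^sup>2) has_field_derivative 2 * Re (cinner (u t) u')) (at t within S)"
  using bounded_bilinear.has_vector_derivative[OF bounded_bilinear_Re_cinner assms assms]
  by (simp add: has_real_derivative_iff_has_vector_derivative Re_cinner_self Re_cinner_commute[of u'])

lemma has_vector_derivative_interior:
  fixes u :: "real \<Rightarrow> 'a::real_normed_vector"
  assumes "(u has_vector_derivative u') (at t within {0..})" and "t > 0"
  shows "(u has_vector_derivative u') (at t)"
proof -
  have "(u has_vector_derivative u') (at t within {0<..})"
    by (rule has_vector_derivative_within_subset[OF assms(1)]) auto
  thus ?thesis by (subst (asm) has_vector_derivative_within_open) (use assms(2) in auto)
qed

text \<open>Semigroup orbits are differentiable within the half-line only. At the endpoint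
  continuity suffices; the mean value argument uses two-sided derivatives at interior
  points.\<close>

lemma nonincreasing_on_halfline:
  fixes f :: "real \<Rightarrow> real"
  assumes "\<And>t. 0 \<le> t \<Longrightarrow> (f has_field_derivative f' t) (at t within {0..})"
    and "\<And>t. 0 \<le> t \<Longrightarrow> f' t \<le> 0" and "0 \<le> t"
  shows "f t \<le> f 0"
proof (cases "t = 0")
  case False
  show ?thesis
  proof (rule DERIV_nonpos_imp_decreasing_open[of 0 t])
    fix s assume "0 < s" "s < t"
    hence "(f has_vector_derivative f' s) (at s)"
      using assms(1)[of s] by (intro has_vector_derivative_interior)
        (auto simp: has_real_derivative_iff_has_vector_derivative)
    thus "\<exists>y. (f has_real_derivative y) (at s) \<and> y \<le> 0"
      using assms(2)[of s] \<open>0 < s\<close> by (auto simp: has_real_derivative_iff_has_vector_derivative)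
  next
    have "continuous_on {0..} f"
      by (rule DERIV_continuous_on) (use assms(1) in auto)
    thus "continuous_on {0..t} f" by (rule continuous_on_subset) auto
  qed (use assms in auto)
qed simp

text \<open>The derivative of exp(2 a t) |u|^2 is nonpositive. The case a = 0 yields uniqueness and
  contractivity for the approximating equations; a = w yields the final decay rate.\<close>

lemma dissipative_decay:
  fixes u :: "real \<Rightarrow> 'a::complex_inner"
  assumes u: "\<And>t. 0 \<le> t \<Longrightarrow> (u has_vector_derivative u' t) (at t within {0..})"
    and diss: "\<And>t. 0 \<le> t \<Longrightarrow> Re (cinner (u t) (u' t)) \<le> - a * (norm (u t))\<^sup>2"
    and t: "0 \<le> t"
  shows "norm (u t) \<le> exp (- a * t) * norm (u 0)"
proof -
  have "exp (2 * a * t) * (norm (u t))\<^sup>2 \<le> exp (2 * a * 0) * (norm (u 0))\<^sup>2"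
  proof (rule nonincreasing_on_halfline[OF _ _ t])
    fix s :: real assume s: "0 \<le> s"
    show "((\<lambda>t. exp (2 * a * t) * (norm (u t))\<^sup>2) has_field_derivative
        2 * exp (2 * a * s) * (a * (norm (u s))\<^sup>2 + Re (cinner (u s) (u' s)))) (at s within {0..})"
      by (rule derivative_eq_intros norm_sq_has_derivative[OF u[OF s]] refl | simp)+
        (simp add: algebra_simps)
    show "2 * exp (2 * a * s) * (a * (norm (u s))\<^sup>2 + Re (cinner (u s) (u' s))) \<le> 0"
      using diss[OF s] by (simp add: mult_le_0_iff)
  qed
  hence "(exp (a * t) * norm (u t))\<^sup>2 \<le> (norm (u 0))\<^sup>2"
    by (simp add: power_mult_distrib exp_double[symmetric] mult.assoc)
  hence "exp (a * t) * norm (u t) \<le> norm (u 0)" by (rule power2_le_imp_le) simp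
  thus ?thesis by (simp add: exp_minus field_simps)
qed

text \<open>The hypothesis is met when u' = G u + f with G dissipative and |f| <= C, so this is the
  Duhamel estimate without an integral.\<close>

lemma dissipative_inhomogeneous_bound:
  fixes u :: "real \<Rightarrow> 'a::complex_inner"
  assumes u: "\<And>t. 0 \<le> t \<Longrightarrow> (u has_vector_derivative u' t) (at t within {0..})"
    and diss: "\<And>t. 0 \<le> t \<Longrightarrow> Re (cinner (u t) (u' t)) \<le> C * norm (u t)"
    and C: "0 \<le> C" and u0: "u 0 = 0" and t: "0 \<le> t"
  shows "norm (u t) \<le> C * t"
proof (rule field_le_epsilon)
  fix e :: real assume e: "e > 0"
  \<comment> \<open>The regularised norm is differentiable also at the zeros of \<open>u\<close>.\<close>
  define g where "g t = sqrt (e\<^sup>2 + (norm (u t))\<^sup>2)" for t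
  have g: "g s > 0" "norm (u s) \<le> g s" for s
    using e by (auto simp: g_def add_pos_nonneg intro: real_le_rsqrt)
  have "g t - C * t \<le> g 0 - C * 0"
  proof (rule nonincreasing_on_halfline[OF _ _ t])
    fix s :: real assume s: "0 \<le> s"
    have pos: "e\<^sup>2 + (norm (u s))\<^sup>2 > 0" using e by (simp add: add_pos_nonneg)
    have "((\<lambda>t. e\<^sup>2 + (norm (u t))\<^sup>2) has_field_derivative 0 + 2 * Re (cinner (u s) (u' s))) (at s within {0..})"
      by (intro DERIV_add DERIV_const norm_sq_has_derivative u s)
    from DERIV_chain2[OF DERIV_real_sqrt[OF pos] this]
    have "(g has_field_derivative Re (cinner (u s) (u' s)) / g s) (at s within {0..})"
      by (simp add: g_def[abs_def] field_simps)
    thus "((\<lambda>t. g t - C * t) has_field_derivative Re (cinner (u s) (u' s)) / g s - C) (at s within {0..})"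
      by (auto intro!: derivative_eq_intros)
    have "Re (cinner (u s) (u' s)) \<le> C * g s"
      using diss[OF s] mult_left_mono[OF g(2)[of s] C] by linarith
    thus "Re (cinner (u s) (u' s)) / g s - C \<le> 0"
      using g(1)[of s] by (simp add: field_simps)
  qed
  hence "g t \<le> C * t + e" using e by (simp add: g_def u0)
  thus "norm (u t) \<le> C * t + e" using g(2)[of t] by linarith
qed

context inverse_dissipative
begin

section \<open>The decomposition of the space\<close>

definition V :: "'a set" where "V = closure (range Q)"

lemma subspace_range: "complex_vector.subspace (range Q)"
proof (rule complex_vector.subspaceI)
  show "0 \<in> range Q" using Q_simps(3) by (metis rangeI)
  show "x + y \<in> range Q" if "x \<in> range Q" "y \<in> range Q" for x y
    using that by (auto simp flip: add)
  show "c *\<^sub>C x \<in> range Q" if "x \<in> range Q" for c x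
    using that by (auto simp flip: scaleC)
qed

lemma subspace_kernel: "complex_vector.subspace {x. Q x = 0}"
  by (rule complex_vector.subspaceI) (simp_all add: Q_simps scaleC)

lemma closed_kernel: "closed {x. Q x = 0}"
  by (intro closed_Collect_eq linear_continuous_on bounded_linear continuous_on_const)

lemma subspace_V: "complex_vector.subspace V"
  unfolding V_def by (rule subspace_closure[OF subspace_range])

lemma closed_V: "closed V" by (simp add: V_def)

lemma Q_in_V: "Q x \<in> V"
  unfolding V_def by (rule subsetD[OF closure_subset rangeI])

lemma V_zero: "0 \<in> V" by (rule complex_vector.subspace_0[OF subspace_V])

lemma V_add: "x \<in> V \<Longrightarrow> y \<in> V \<Longrightarrow> x + y \<in> V"
  by (rule complex_vector.subspace_add[OF subspace_V])

lemma V_diff: "x \<in> V \<Longrightarrow> y \<in> V \<Longrightarrow> x - y \<in> V"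
  by (rule complex_vector.subspace_diff[OF subspace_V])

lemma V_scaleC: "x \<in> V \<Longrightarrow> c *\<^sub>C x \<in> V"
  by (rule complex_vector.subspace_scale[OF subspace_V])

lemma V_scaleR: "x \<in> V \<Longrightarrow> r *\<^sub>R x \<in> V"
  by (rule subspace_scaleR[OF subspace_V])

text \<open>By dissipativity, the kernels of \<open>Q\<close> and of its adjoint coincide.\<close>

lemma kernel_iff_orthogonal: "Q x = 0 \<longleftrightarrow> (\<forall>y. cinner (Q y) x = 0)"
proof -
  define K where "K = adj UNIV Q"
  have QK: "cinner (Q y) z = cinner y (K z)" for y z
    unfolding K_def by (rule cinner_adj[OF bounded_clinear])
  have KQ: "cinner (K y) z = cinner y (Q z)" for y z
    using QK[of z y] by (metis cinner_commute)
  have K_diss: "Re (cinner x (K x)) \<le> - w * (norm (K x))\<^sup>2" for x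
    by (rule inverse_dissipative_adjoint[OF KQ w_pos diss])
  \<comment> \<open>Both quadratic forms have the same real part, so if one of K x and Q x vanishes,
    the dissipativity inequality for the other forces it to vanish too.\<close>
  have sym: "Re (cinner x (K x)) = Re (cinner x (Q x))" for x
    by (metis QK Re_cinner_commute)
  have zero: "y = 0" if "0 \<le> - w * (norm y)\<^sup>2" for y :: 'a
    using that w_pos by (auto simp: mult_le_0_iff)
  have "Q x = 0 \<longleftrightarrow> K x = 0"
  proof
    assume "Q x = 0"
    thus "K x = 0" using K_diss[of x] sym[of x] by (intro zero) simp
  next
    assume "K x = 0"
    thus "Q x = 0" using diss[of x] sym[of x] by (intro zero) simp
  qed
  also have "K x = 0 \<longleftrightarrow> (\<forall>y. cinner (Q y) x = 0)"
    unfolding QK using cinner_self[of "K x"] by auto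
  finally show ?thesis .
qed

lemma kernel_orthogonal_V:
  assumes "Q x = 0" and "v \<in> V"
  shows "cinner v x = 0"
proof -
  have "closed {v. cinner v x = 0}"
    by (intro closed_Collect_eq continuous_intros linear_continuous_on
        bounded_bilinear.bounded_linear_left[OF bounded_bilinear_cinner])
  moreover have "range Q \<subseteq> {v. cinner v x = 0}"
    using assms(1) kernel_iff_orthogonal by auto
  ultimately have "V \<subseteq> {v. cinner v x = 0}" unfolding V_def by (rule closure_minimal[rotated])
  thus ?thesis using assms(2) by blast
qed

lemma decomposition: "\<exists>v\<in>V. Q (x - v) = 0"
proof -
  obtain v where v: "v \<in> V" "\<And>y. y \<in> V \<Longrightarrow> cinner (x - v) y = 0"
    using orthogonal_decomposition[OF subspace_V closed_V, of x] by blast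
  have "cinner (Q y) (x - v) = 0" for y
    using v(2)[OF Q_in_V[of y]] by (metis cinner_commute complex_cnj_zero)
  thus ?thesis using v(1) kernel_iff_orthogonal by blast
qed

lemma kernel_inter_V: "Q x = 0 \<Longrightarrow> x \<in> V \<Longrightarrow> x = 0"
  using kernel_orthogonal_V[of x x] by (simp add: cinner_self)

lemma closed_direct_sum_kernel_V: "closed_direct_sum {x. Q x = 0} V"
proof -
  have "\<exists>u\<in>{x. Q x = 0}. \<exists>v\<in>V. x = u + v" for x
  proof -
    obtain v where "v \<in> V" "Q (x - v) = 0" using decomposition by blast
    thus ?thesis by (intro bexI[of _ "x - v"] bexI[of _ v]) auto
  qed
  thus ?thesis
    unfolding closed_direct_sum_def
    using subspace_kernel closed_kernel subspace_V closed_V kernel_inter_V V_zero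
    by (auto simp: Q_simps)
qed

text \<open>The orthogonal projection onto V, specified through Q: identities such as linearity then
  follow from uniqueness of the decomposition and linearity of Q.\<close>

definition P :: "'a \<Rightarrow> 'a" where "P x = (SOME v. v \<in> V \<and> Q (x - v) = 0)"

lemma P: "P x \<in> V" "Q (x - P x) = 0"
  using someI_ex[of "\<lambda>v. v \<in> V \<and> Q (x - v) = 0"] decomposition[of x] by (auto simp: P_def)

lemma P_eqI:
  assumes "v \<in> V" and "Q (x - v) = 0"
  shows "P x = v"
proof -
  have "Q (v - P x) = 0" using P(2)[of x] assms(2) by (simp add: Q_simps)
  hence "v - P x = 0" by (rule kernel_inter_V[OF _ V_diff[OF assms(1) P(1)]])
  thus ?thesis by simp
qed

lemma P_eq: "Q u = 0 \<Longrightarrow> v \<in> V \<Longrightarrow> P (u + v) = v"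
  by (rule P_eqI) auto

lemma P_add: "P (x + y) = P x + P y"
  by (rule P_eqI) (use P in \<open>auto simp: Q_simps V_add\<close>)

lemma P_scaleC: "P (c *\<^sub>C x) = c *\<^sub>C P x"
  by (rule P_eqI) (use P in \<open>auto simp: scaleC V_scaleC simp flip: scaleC_diff_right\<close>)

lemma norm_P_le: "norm (P x) \<le> norm x"
proof (rule power2_le_imp_le)
  have "(norm x)\<^sup>2 = (norm (P x + (x - P x)))\<^sup>2" by simp
  also have "\<dots> = (norm (P x))\<^sup>2 + (norm (x - P x))\<^sup>2"
    unfolding norm_add_sq using kernel_orthogonal_V[OF P(2) P(1)] by simp
  finally show "(norm (P x))\<^sup>2 \<le> (norm x)\<^sup>2" by simp
qed simp

lemma Q_P: "Q (P x) = Q x"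
  using P(2)[of x] by (simp add: Q_simps)

text \<open>Since Q y = Q (P y), V already produces the whole range of Q. This is density of the
  domain of A_R in V; limits are first taken on that domain and then extended by uniform
  bounds.\<close>

lemma dense_Q_V:
  assumes "x \<in> V" and "e > 0"
  shows "\<exists>v\<in>V. norm (x - Q v) < e"
proof -
  have "\<exists>q\<in>range Q. dist q x < e"
    using assms closure_approachable[of x "range Q"] by (simp only: V_def)
  then obtain y where "dist (Q y) x < e" by auto
  thus ?thesis using P(1)[of y] Q_P[of y]
    by (intro bexI[of _ "P y"]) (auto simp: dist_norm norm_minus_commute)
qed

section \<open>Yosida approximation\<close>

text \<open>On V, where A_R is inverse to Q, this is A_R (A_R - n)^{-1}, so \<open>G n\<close> is
  the usual Yosida approximant n A_R (n - A_R)^{-1}. The familiar n (n - A_R)^{-1} is 1 - J n; hence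
  \<open>J n\<close> is expected to tend to 0, not to the identity.\<close>

definition J :: "real \<Rightarrow> 'a \<Rightarrow> 'a" where "J n = inv (\<lambda>x. x - n *\<^sub>R Q x)"

definition G :: "real \<Rightarrow> 'a \<Rightarrow> 'a" where "G n x = - n *\<^sub>R J n x"

context
  fixes n :: real
  assumes n: "0 \<le> n"
begin

lemma bij_shift: "bij (\<lambda>x. x - n *\<^sub>R Q x)"
  using shift_bij n w_pos by simp

lemma J_right: "J n x - n *\<^sub>R Q (J n x) = x"
  unfolding J_def using surj_f_inv_f[OF bij_is_surj[OF bij_shift]] by simp

lemma J_eqI: "v - n *\<^sub>R Q v = x \<Longrightarrow> J n x = v"
  unfolding J_def using inv_f_f[OF bij_is_inj[OF bij_shift], of v] by simp

lemma J_add: "J n (x + y) = J n x + J n y"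
proof (rule J_eqI)
  have "J n x + J n y - n *\<^sub>R Q (J n x + J n y) = (J n x - n *\<^sub>R Q (J n x)) + (J n y - n *\<^sub>R Q (J n y))"
    by (simp add: Q_simps algebra_simps)
  thus "J n x + J n y - n *\<^sub>R Q (J n x + J n y) = x + y" by (simp only: J_right)
qed

lemma J_scaleC: "J n (c *\<^sub>C x) = c *\<^sub>C J n x"
proof (rule J_eqI)
  have "c *\<^sub>C J n x - n *\<^sub>R Q (c *\<^sub>C J n x) = c *\<^sub>C (J n x - n *\<^sub>R Q (J n x))"
    by (simp add: scaleC scaleC_diff_right scaleR_scaleC scaleC_scaleC mult.commute)
  thus "c *\<^sub>C J n x - n *\<^sub>R Q (c *\<^sub>C J n x) = c *\<^sub>C x" by (simp only: J_right)
qed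

lemma J_Q: "J n (Q x) = Q (J n x)"
proof (rule J_eqI)
  have "Q (J n x) - n *\<^sub>R Q (Q (J n x)) = Q (J n x - n *\<^sub>R Q (J n x))" by (simp add: Q_simps)
  thus "Q (J n x) - n *\<^sub>R Q (Q (J n x)) = Q x" by (simp only: J_right)
qed

text \<open>Pair x = v - n Q v with v = J n x; the term in Q v contributes nonnegatively. Both the
  contractivity of \<open>J n\<close> and the dissipativity of \<open>G n\<close> come from
  this.\<close>

lemma Re_cinner_J: "(norm (J n x))\<^sup>2 \<le> Re (cinner x (J n x))"
proof -
  have "Re (cinner (J n x) (Q (J n x))) \<le> 0"
    using diss[of "J n x"] w_pos by (smt (verit) mult_nonneg_nonneg zero_le_power2 mult_minus_left)
  hence "n * Re (cinner (Q (J n x)) (J n x)) \<le> 0"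
    using n by (simp add: Re_cinner_commute[of "Q (J n x)"] mult_nonneg_nonpos)
  moreover have "Re (cinner (J n x - n *\<^sub>R Q (J n x)) (J n x)) =
      (norm (J n x))\<^sup>2 - n * Re (cinner (Q (J n x)) (J n x))"
    by (simp add: cinner_simps Re_cinner_self)
  ultimately show ?thesis unfolding J_right by linarith
qed

lemma norm_J_le: "norm (J n x) \<le> norm x"
proof (cases "J n x = 0")
  case False
  have "norm (J n x) * norm (J n x) \<le> norm x * norm (J n x)"
    using Re_cinner_J[of x] Re_cinner_le_norm[of x "J n x"] by (simp add: power2_eq_square)
  thus ?thesis using False by simp
qed simp

lemma bounded_clinear_G: "bounded_clinear (G n)"
  by (rule bounded_clinearI[where C = n])
    (use n in \<open>auto simp: G_def J_add J_scaleC scaleR_diff_right scaleC_minus_right scaleR_scaleC scaleC_scaleC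
      mult.commute norm_J_le mult_left_mono scaleC_add_right norm_scaleC\<close>)

lemma J_in_V: "x \<in> V \<Longrightarrow> J n x \<in> V"
  using V_add[OF _ V_scaleR[OF Q_in_V], of x n "J n x"] J_right[of x] by (simp add: algebra_simps)

lemma G_in_V: "x \<in> V \<Longrightarrow> G n x \<in> V"
  unfolding G_def by (intro V_scaleR J_in_V)

lemma G_dissipative: "Re (cinner x (G n x)) \<le> 0"
proof -
  have "0 \<le> Re (cinner x (J n x))" using Re_cinner_J[of x] by (smt (verit) zero_le_power2)
  thus ?thesis using n by (simp add: G_def cinner_simps)
qed

text \<open>On the range of Q the approximants are bounded uniformly in n, although the general
  bound for \<open>G n\<close> grows like n. This is why estimates below pass through vectors
  \<open>Q v\<close>.\<close>

lemma G_Q: "G n (Q x) = x - J n x"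
  using J_right[of x] by (simp add: G_def J_Q algebra_simps)

lemma norm_G_Q_le: "norm (G n (Q x)) \<le> 2 * norm x"
  unfolding G_Q using norm_triangle_ineq4[of x "J n x"] norm_J_le[of x] by linarith

lemma norm_J_Q_le: "n * norm (J n (Q x)) \<le> 2 * norm x"
  using norm_G_Q_le[of x] n by (simp add: G_def)

end

lemma J_commute:
  assumes "0 \<le> n" "0 \<le> m"
  shows "J n (J m x) = J m (J n x)"
proof (rule J_eqI[OF assms(1)])
  have "J m (J n x) - n *\<^sub>R Q (J m (J n x)) = J m (J n x) + (- n) *\<^sub>R J m (Q (J n x))"
    by (simp add: J_Q[OF assms(2)])
  also have "\<dots> = J m (J n x - n *\<^sub>R Q (J n x))"
    using J_add[OF assms(2), of "J n x" "(- n) *\<^sub>R Q (J n x)"] J_scaleC[OF assms(2), of "of_real (- n)" "Q (J n x)"]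
    by (simp add: scaleR_scaleC[symmetric])
  finally show "J m (J n x) - n *\<^sub>R Q (J m (J n x)) = J m x" by (simp only: J_right[OF assms(1)])
qed

lemma G_commute:
  assumes "0 \<le> n" "0 \<le> m"
  shows "G n (G m x) = G m (G n x)"
proof -
  have J_scaleR: "J k (r *\<^sub>R x) = r *\<^sub>R J k x" if "0 \<le> k" for k r x
    unfolding scaleR_scaleC by (rule J_scaleC[OF that])
  show ?thesis by (simp only: G_def J_scaleR[OF assms(1)] J_scaleR[OF assms(2)] J_commute[OF assms]
      scaleR_scaleR mult.commute)
qed

text \<open>On vectors \<open>Q v\<close> the decay is of order 2 |v| / n; contractivity of
  \<open>J n\<close> extends the limit to V. The factor 4 in the choice of N makes that term smaller
  than e/2.\<close>

lemma J_tendsto_zero: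
  assumes "x \<in> V"
  shows "(\<lambda>n. J (real n) x) \<longlonglongrightarrow> 0"
proof (rule LIMSEQ_I)
  fix e :: real assume e: "e > 0"
  obtain v where v: "norm (x - Q v) < e / 2" using dense_Q_V[OF assms, of "e/2"] e by auto
  obtain N where N: "4 * norm v / e < real N" using reals_Archimedean2 by blast
  have "norm (J (real k) x - 0) < e" if k: "k \<ge> N" for k
  proof -
    have "4 * norm v / e < real k" using N k by linarith
    hence vk: "4 * norm v < e * real k" using e by (simp add: pos_divide_less_eq mult.commute)
    have k0: "0 < real k"
      using e by (intro le_less_trans[OF _ \<open>4 * norm v / e < real k\<close>]) simp
    have "norm (J (real k) x) = norm (J (real k) (x - Q v) + J (real k) (Q v))"
      by (simp flip: J_add)
    also have "\<dots> \<le> norm (J (real k) (x - Q v)) + norm (J (real k) (Q v))" by (rule norm_triangle_ineq)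
    also have "\<dots> < e / 2 + e / 2"
    proof (rule add_strict_mono)
      show "norm (J (real k) (x - Q v)) < e / 2" using norm_J_le[of "real k" "x - Q v"] v by simp
      have "real k * norm (J (real k) (Q v)) < real k * (e / 2)"
        using norm_J_Q_le[of "real k" v] vk by (simp add: mult.commute)
      thus "norm (J (real k) (Q v)) < e / 2" using k0 by simp
    qed
    finally show ?thesis by simp
  qed
  thus "\<exists>N. \<forall>k\<ge>N. norm (J (real k) x - 0) < e" by blast
qed

lemma G_tendsto: "x \<in> V \<Longrightarrow> (\<lambda>n. G (real n) (Q x)) \<longlonglongrightarrow> x"
  using tendsto_diff[OF tendsto_const J_tendsto_zero, of x x] by (simp add: G_Q)

section \<open>Existence of the semigroup\<close>

text \<open>For x in V this is exp(t G_n) x. The choice is made once for the whole trajectory, which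
  is then evaluated at t; outside V no trajectory qualifies and the value is arbitrary.\<close>

definition S :: "real \<Rightarrow> real \<Rightarrow> 'a \<Rightarrow> 'a"
  where "S n t x = (SOME u. u 0 = x \<and> (\<forall>t. (u has_vector_derivative G n (u t)) (at t)) \<and> (\<forall>t. u t \<in> V)) t"

context
  fixes n :: real
  assumes n: "0 \<le> n"
begin

lemma bounded_linear_G: "bounded_linear (G n)"
  by (rule bounded_clinear_bounded_linear[OF bounded_clinear_G[OF n]])

lemmas G_simps = linear_simps[OF bounded_linear_G]

lemma S_props:
  assumes "x \<in> V"
  shows "S n 0 x = x" "((\<lambda>t. S n t x) has_vector_derivative G n (S n t x)) (at t)" "S n t x \<in> V"
proof -
  have "\<exists>u. u 0 = x \<and> (\<forall>t. (u has_vector_derivative G n (u t)) (at t)) \<and> (\<forall>t. u t \<in> V)"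
    by (rule linear_ode_solution_exists[OF bounded_linear_G closed_V V_zero V_add V_scaleR G_in_V[OF n] assms])
  from someI_ex[OF this]
  show "S n 0 x = x" "((\<lambda>t. S n t x) has_vector_derivative G n (S n t x)) (at t)" "S n t x \<in> V"
    by (simp_all add: S_def)
qed

lemma S_deriv_within:
  "x \<in> V \<Longrightarrow> ((\<lambda>t. S n t x) has_vector_derivative G n (S n t x)) (at t within T)"
  by (rule has_vector_derivative_at_within[OF S_props(2)])

text \<open>The difference of two solutions solves the same dissipative equation with initial value
  0.\<close>

lemma S_unique:
  assumes v: "\<And>t. 0 \<le> t \<Longrightarrow> (v has_vector_derivative G n (v t)) (at t within {0..})"
    and "v 0 = x" and x: "x \<in> V" and t: "0 \<le> t"
  shows "S n t x = v t"
proof -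
  have "norm (S n t x - v t) \<le> exp (- 0 * t) * norm (S n 0 x - v 0)"
  proof (rule dissipative_decay[OF _ _ t])
    fix s :: real assume "0 \<le> s"
    show "((\<lambda>t. S n t x - v t) has_vector_derivative G n (S n s x - v s)) (at s within {0..})"
      unfolding G_simps by (intro has_vector_derivative_diff S_deriv_within v x \<open>0 \<le> s\<close>)
    show "Re (cinner (S n s x - v s) (G n (S n s x - v s))) \<le> - 0 * (norm (S n s x - v s))\<^sup>2"
      using G_dissipative[OF n] by simp
  qed
  thus ?thesis using S_props(1)[OF x] assms(2) by simp
qed

lemma S_contraction:
  assumes x: "x \<in> V" and t: "0 \<le> t"
  shows "norm (S n t x) \<le> norm x"
proof -
  have "norm (S n t x) \<le> exp (- 0 * t) * norm (S n 0 x)"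
    by (rule dissipative_decay[OF S_deriv_within[OF x] _ t]) (use G_dissipative[OF n] in auto)
  thus ?thesis using S_props(1)[OF x] by simp
qed

lemma S_add:
  assumes "x \<in> V" "y \<in> V" "0 \<le> t"
  shows "S n t (x + y) = S n t x + S n t y"
  by (rule S_unique)
    (use assms in \<open>auto simp: S_props G_simps V_add intro!: has_vector_derivative_add S_deriv_within\<close>)

text \<open>An operator commuting with \<open>G n\<close> maps trajectories to trajectories. It is
  applied to complex scalars and to the operators \<open>G k\<close>.\<close>

lemma S_compose:
  assumes B: "bounded_linear B" and BG: "\<And>x. B (G n x) = G n (B x)" and BV: "\<And>x. x \<in> V \<Longrightarrow> B x \<in> V"
    and x: "x \<in> V" and t: "0 \<le> t"
  shows "S n t (B x) = B (S n t x)"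
proof (rule S_unique)
  show "((\<lambda>t. B (S n t x)) has_vector_derivative G n (B (S n s x))) (at s within {0..})" for s
    unfolding BG[symmetric] by (rule bounded_linear.has_vector_derivative[OF B S_deriv_within[OF x]])
qed (simp_all add: S_props BV x t)

lemma S_scaleC:
  assumes "x \<in> V" "0 \<le> t"
  shows "S n t (c *\<^sub>C x) = c *\<^sub>C S n t x"
  by (rule S_compose[OF bounded_linear_scaleC _ V_scaleC assms])
    (simp_all add: bounded_clinear_scaleC[OF bounded_clinear_G[OF n]])

lemma S_diff:
  assumes "x \<in> V" "y \<in> V" "0 \<le> t"
  shows "S n t (x - y) = S n t x - S n t y"
  using S_add[OF V_diff[OF assms(1,2)] assms(2,3)] by (simp add: algebra_simps)

lemma S_semigroup:
  assumes x: "x \<in> V" and s: "0 \<le> s" and t: "0 \<le> t"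
  shows "S n (s + t) x = S n s (S n t x)"
proof -
  have "S n s (S n t x) = S n (s + t) x"
  proof (rule S_unique[where v = "\<lambda>s. S n (s + t) x"])
    fix r :: real
    have "((\<lambda>s. S n s x) \<circ> (\<lambda>s. s + t) has_vector_derivative 1 *\<^sub>R G n (S n (r + t) x)) (at r)"
      by (intro vector_diff_chain_at S_props(2)[OF x]) (auto intro!: derivative_eq_intros)
    thus "((\<lambda>s. S n (s + t) x) has_vector_derivative G n (S n (r + t) x)) (at r within {0..})"
      unfolding comp_def scaleR_one by (rule has_vector_derivative_at_within)
  qed (simp_all add: S_props x s)
  thus ?thesis by simp
qed

text \<open>The difference u = S n t x - x solves u' = G n u + G n x with u(0) = 0.\<close>

lemma norm_S_diff_id:
  assumes x: "x \<in> V" and t: "0 \<le> t"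
  shows "norm (S n t x - x) \<le> norm (G n x) * t"
proof (rule dissipative_inhomogeneous_bound[OF _ _ _ _ t])
  fix s :: real assume "0 \<le> s"
  show "((\<lambda>t. S n t x - x) has_vector_derivative G n (S n s x - x) + G n x) (at s within {0..})"
    using has_vector_derivative_diff[OF S_deriv_within[OF x] has_vector_derivative_const]
    by (simp add: G_simps)
  show "Re (cinner (S n s x - x) (G n (S n s x - x) + G n x)) \<le> norm (G n x) * norm (S n s x - x)"
    using G_dissipative[OF n, of "S n s x - x"] Re_cinner_le_norm[of "S n s x - x" "G n x"]
    by (simp add: cinner_add_right mult.commute)
qed (simp_all add: S_props x)

text \<open>The bound must survive n tending to infinity, so y is replaced by a nearby
  \<open>Q v\<close>, on which \<open>G n\<close> is controlled by 2 |v|; contractivity handles the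
  error.\<close>

lemma norm_S_diff_id_uniform:
  assumes "y \<in> V" "v \<in> V" and t: "0 \<le> t"
  shows "norm (S n t y - y) \<le> 2 * norm (y - Q v) + 2 * norm v * t"
proof -
  have "S n t y - y = S n t (y - Q v) - (y - Q v) + (S n t (Q v) - Q v)"
    using S_diff[OF assms(1) Q_in_V t] by simp
  hence "norm (S n t y - y) \<le> norm (S n t (y - Q v)) + norm (y - Q v) + norm (S n t (Q v) - Q v)"
    by (metis norm_triangle_le norm_triangle_ineq4 add_mono order_refl)
  moreover have "norm (S n t (y - Q v)) \<le> norm (y - Q v)"
    by (intro S_contraction V_diff assms Q_in_V)
  moreover have "norm (S n t (Q v) - Q v) \<le> 2 * norm v * t"
    using norm_S_diff_id[OF Q_in_V t, of v] mult_right_mono[OF norm_G_Q_le[OF n, of v] t] by linarith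
  ultimately show ?thesis by linarith
qed

text \<open>The trajectory from \<open>Q u\<close> has derivative S n s g with g = G n (Q u), so the
  linearisation error is governed by S n s g - g. Comparing g with u isolates a term that vanishes
  as n grows and leaves an estimate uniform in n.\<close>

lemma S_generator_bound:
  assumes u: "u \<in> V" and v: "v \<in> V" and t: "0 \<le> t"
  shows "norm (S n t (Q u) - Q u - t *\<^sub>R G n (Q u)) \<le>
    t * (2 * norm (G n (Q u) - u) + (2 * norm (u - Q v) + 2 * norm v * t))"
proof -
  define g where "g = G n (Q u)"
  have g: "g \<in> V" unfolding g_def by (intro G_in_V n Q_in_V)
  have SG: "S n s g = G n (S n s (Q u))" if "0 \<le> s" for s
    unfolding g_def by (intro S_compose bounded_linear_G G_in_V n Q_in_V that) simp
  have "norm (S n t (Q u) - S n 0 (Q u) - (t - 0) *\<^sub>R S n 0 g) \<le>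
      norm (t - 0) * (2 * norm (g - u) + (2 * norm (u - Q v) + 2 * norm v * t))"
  proof (rule vector_differentiable_bound_linearization)
    show "((\<lambda>t. S n t (Q u)) has_vector_derivative S n s g) (at s within {0..t})" if "s \<in> {0..t}" for s
      using S_deriv_within[OF Q_in_V, of u s "{0..t}"] SG[of s] that by simp
    show "closed_segment 0 t \<subseteq> {0..t}" using t by (simp add: closed_segment_eq_real_ivl)
    show "0 \<in> {0..t}" using t by simp
    fix s assume s: "s \<in> {0..t}"
    have s0: "0 \<le> s" using s by simp
    have "S n s g - g = S n s (g - u) - (g - u) + (S n s u - u)"
      using S_diff[OF g u s0] by simp
    hence "norm (S n s g - g) \<le> norm (S n s (g - u)) + norm (g - u) + norm (S n s u - u)"
      by (metis norm_triangle_le norm_triangle_ineq4 add_mono order_refl)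
    moreover have "norm (S n s (g - u)) \<le> norm (g - u)"
      by (intro S_contraction V_diff g u s0)
    moreover have "norm (S n s u - u) \<le> 2 * norm (u - Q v) + 2 * norm v * s"
      by (rule norm_S_diff_id_uniform[OF u v s0])
    moreover have "2 * norm v * s \<le> 2 * norm v * t" using s by (intro mult_left_mono) auto
    ultimately show "norm (S n s g - S n 0 g) \<le> 2 * norm (g - u) + (2 * norm (u - Q v) + 2 * norm v * t)"
      unfolding S_props(1)[OF g] by linarith
  qed
  thus ?thesis using t by (simp add: S_props(1) g Q_in_V g_def[symmetric])
qed

end

section \<open>Convergence of the approximating semigroups\<close>

lemma S_compare:
  assumes n: "0 \<le> n" and m: "0 \<le> m" and x: "x \<in> V" and t: "0 \<le> t"
  shows "norm (S n t x - S m t x) \<le> norm (G n x - G m x) * t"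
proof (rule dissipative_inhomogeneous_bound[OF _ _ _ _ t])
  fix s :: real assume s: "0 \<le> s"
  have comm: "S m s (G k x) = G k (S m s x)" if "0 \<le> k" for k
    by (intro S_compose m bounded_linear_G G_in_V G_commute x s that)
  \<comment> \<open>The difference of the two trajectories solves the equation for
    \<open>G n\<close> with this inhomogeneity. Commuting \<open>G n\<close> past \<open>S m\<close>
    moves the discrepancy to the initial vector, where contractivity bounds it independently of
    s.\<close>
  have eq: "G n (S n s x - S m s x) + S m s (G n x - G m x) = G n (S n s x) - G m (S m s x)"
    by (simp add: G_simps[OF n] S_diff[OF m] comm n m x s G_in_V)
  show "((\<lambda>t. S n t x - S m t x) has_vector_derivative
      G n (S n s x - S m s x) + S m s (G n x - G m x)) (at s within {0..})"
    unfolding eq by (intro has_vector_derivative_diff S_deriv_within n m x)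
  have "norm (S m s (G n x - G m x)) \<le> norm (G n x - G m x)"
    by (intro S_contraction V_diff G_in_V n m x s)
  hence "norm (S n s x - S m s x) * norm (S m s (G n x - G m x)) \<le> norm (S n s x - S m s x) * norm (G n x - G m x)"
    by (rule mult_left_mono) simp
  thus "Re (cinner (S n s x - S m s x) (G n (S n s x - S m s x) + S m s (G n x - G m x)))
      \<le> norm (G n x - G m x) * norm (S n s x - S m s x)"
    using G_dissipative[OF n, of "S n s x - S m s x"]
      Re_cinner_le_norm[of "S n s x - S m s x" "S m s (G n x - G m x)"]
    by (simp add: cinner_add_right mult.commute)
qed (simp_all add: S_props n m x)

lemma S_Cauchy:
  assumes x: "x \<in> V" and t: "0 \<le> t"
  shows "Cauchy (\<lambda>n. S (real n) t x)"
proof (rule metric_CauchyI)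
  fix e :: real assume e: "e > 0"
  obtain v where v: "v \<in> V" "norm (x - Q v) < e / 4" using dense_Q_V[OF x, of "e/4"] e by auto
  have "Cauchy (\<lambda>n. G (real n) (Q v))"
    by (rule LIMSEQ_imp_Cauchy[OF G_tendsto[OF v(1)]])
  \<comment> \<open>The generators converge on \<open>Q v\<close>, and multiplying this tolerance by
    t costs at most e/2; \<open>t + 1\<close> covers t = 0. Replacing x by \<open>Q v\<close> costs
    another e/4 in each semigroup.\<close>
  moreover have "e / (2 * (t + 1)) > 0" using e t by simp
  ultimately obtain N where N: "\<And>n m. n \<ge> N \<Longrightarrow> m \<ge> N \<Longrightarrow>
      norm (G (real n) (Q v) - G (real m) (Q v)) < e / (2 * (t + 1))"
    unfolding Cauchy_def dist_norm by meson
  have "dist (S (real n) t x) (S (real m) t x) < e" if nm: "n \<ge> N" "m \<ge> N" for n m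
  proof -
    have near: "norm (S (real k) t x - S (real k) t (Q v)) \<le> norm (x - Q v)" for k
      using S_contraction[of "real k" "x - Q v" t] S_diff[of "real k" x "Q v" t] x t
      by (simp add: Q_in_V V_diff)
    have "norm (S (real n) t (Q v) - S (real m) t (Q v)) \<le> e / (2 * (t + 1)) * t"
      using S_compare[of "real n" "real m" "Q v" t] mult_right_mono[OF less_imp_le[OF N[OF nm]] t] t
      by (simp add: Q_in_V)
    also have "\<dots> \<le> e / 2" using e t by (simp add: field_simps)
    finally have mid: "norm (S (real n) t (Q v) - S (real m) t (Q v)) \<le> e / 2" .
    have "S (real n) t x - S (real m) t x = (S (real n) t x - S (real n) t (Q v)) +
        ((S (real n) t (Q v) - S (real m) t (Q v)) - (S (real m) t x - S (real m) t (Q v)))"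
      by simp
    also have "norm \<dots> \<le> norm (S (real n) t x - S (real n) t (Q v)) +
        (norm (S (real n) t (Q v) - S (real m) t (Q v)) + norm (S (real m) t x - S (real m) t (Q v)))"
      by (meson norm_triangle_ineq norm_triangle_ineq4 order_trans add_left_mono)
    also have "\<dots> < e" using near[of n] near[of m] mid v(2) by linarith
    finally show ?thesis by (simp add: dist_norm)
  qed
  thus "\<exists>N. \<forall>n\<ge>N. \<forall>m\<ge>N. dist (S (real n) t x) (S (real m) t x) < e" by blast
qed

section \<open>The limit semigroup and its generator\<close>

definition U :: "real \<Rightarrow> 'a \<Rightarrow> 'a" where "U t x = lim (\<lambda>n. S (real n) t x)"

lemma S_tendsto_U: "x \<in> V \<Longrightarrow> 0 \<le> t \<Longrightarrow> (\<lambda>n. S (real n) t x) \<longlonglongrightarrow> U t x"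
  unfolding U_def by (rule convergent_LIMSEQ_iff[THEN iffD1, OF Cauchy_convergent[OF S_Cauchy]])

lemma U_in_V: "x \<in> V \<Longrightarrow> 0 \<le> t \<Longrightarrow> U t x \<in> V"
  by (rule closed_sequentially[OF closed_V _ S_tendsto_U]) (simp_all add: S_props)

lemma U_zero: "x \<in> V \<Longrightarrow> U 0 x = x"
  using LIMSEQ_unique[OF S_tendsto_U[of x 0]] by (simp add: S_props)

lemma U_contraction: "x \<in> V \<Longrightarrow> 0 \<le> t \<Longrightarrow> norm (U t x) \<le> norm x"
  by (rule LIMSEQ_le_const2[OF tendsto_norm[OF S_tendsto_U]]) (auto simp: S_contraction)

lemma U_add:
  assumes "x \<in> V" "y \<in> V" "0 \<le> t"
  shows "U t (x + y) = U t x + U t y"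
proof (rule LIMSEQ_unique)
  show "(\<lambda>n. S (real n) t (x + y)) \<longlonglongrightarrow> U t (x + y)" by (intro S_tendsto_U V_add assms)
  show "(\<lambda>n. S (real n) t (x + y)) \<longlonglongrightarrow> U t x + U t y"
    using assms by (simp add: S_add tendsto_add S_tendsto_U)
qed

lemma U_scaleC:
  assumes "x \<in> V" "0 \<le> t"
  shows "U t (c *\<^sub>C x) = c *\<^sub>C U t x"
proof (rule LIMSEQ_unique)
  show "(\<lambda>n. S (real n) t (c *\<^sub>C x)) \<longlonglongrightarrow> U t (c *\<^sub>C x)" by (intro S_tendsto_U V_scaleC assms)
  show "(\<lambda>n. S (real n) t (c *\<^sub>C x)) \<longlonglongrightarrow> c *\<^sub>C U t x"
    using bounded_linear.tendsto[OF bounded_linear_scaleC[of c] S_tendsto_U[OF assms]] assms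
    by (simp add: S_scaleC)
qed

lemma U_semigroup:
  assumes x: "x \<in> V" and s: "0 \<le> s" and t: "0 \<le> t"
  shows "U (s + t) x = U s (U t x)"
proof (rule LIMSEQ_unique)
  show "(\<lambda>n. S (real n) (s + t) x) \<longlonglongrightarrow> U (s + t) x" using x s t by (simp add: S_tendsto_U)
  \<comment> \<open>Both the outer semigroup and its argument vary with n; contractivity lets the
    argument be replaced by its limit first.\<close>
  have "(\<lambda>n. S (real n) s (S (real n) t x - U t x)) \<longlonglongrightarrow> 0"
  proof (rule Lim_null_comparison)
    show "(\<lambda>n. norm (S (real n) t x - U t x)) \<longlonglongrightarrow> 0"
      using S_tendsto_U[OF x t] by (simp add: LIM_zero tendsto_norm_zero)
    show "\<forall>\<^sub>F n in sequentially. norm (S (real n) s (S (real n) t x - U t x)) \<le> norm (S (real n) t x - U t x)"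
      by (intro always_eventually allI S_contraction V_diff U_in_V S_props x s t) simp_all
  qed
  from tendsto_add[OF this S_tendsto_U[OF U_in_V[OF x t] s]]
  have "(\<lambda>n. S (real n) s (S (real n) t x - U t x) + S (real n) s (U t x)) \<longlonglongrightarrow> U s (U t x)" by simp
  moreover have "S (real n) s (S (real n) t x - U t x) + S (real n) s (U t x) = S (real n) (s + t) x" for n
    using x s t by (simp add: S_diff S_props U_in_V S_semigroup)
  ultimately show "(\<lambda>n. S (real n) (s + t) x) \<longlonglongrightarrow> U s (U t x)" by simp
qed

lemma norm_U_diff_id:
  assumes "y \<in> V" "v \<in> V" and t: "0 \<le> t"
  shows "norm (U t y - y) \<le> 2 * norm (y - Q v) + 2 * norm v * t"
  by (rule LIMSEQ_le_const2[OF tendsto_norm[OF tendsto_diff[OF S_tendsto_U[OF assms(1) t] tendsto_const]]])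
    (auto intro!: norm_S_diff_id_uniform assms)

lemma U_generator_bound:
  assumes u: "u \<in> V" and v: "v \<in> V" and t: "0 \<le> t"
  shows "norm (U t (Q u) - Q u - t *\<^sub>R u) \<le> t * (2 * norm (u - Q v) + 2 * norm v * t)"
proof (rule LIMSEQ_le)
  show "(\<lambda>n. norm (S (real n) t (Q u) - Q u - t *\<^sub>R G (real n) (Q u))) \<longlonglongrightarrow> norm (U t (Q u) - Q u - t *\<^sub>R u)"
    by (intro tendsto_intros S_tendsto_U Q_in_V t G_tendsto u)
  have "(\<lambda>n. t * (2 * norm (G (real n) (Q u) - u) + (2 * norm (u - Q v) + 2 * norm v * t))) \<longlonglongrightarrow>
      t * (2 * norm (u - u) + (2 * norm (u - Q v) + 2 * norm v * t))"
    by (intro tendsto_intros G_tendsto u)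
  thus "(\<lambda>n. t * (2 * norm (G (real n) (Q u) - u) + (2 * norm (u - Q v) + 2 * norm v * t))) \<longlonglongrightarrow>
      t * (2 * norm (u - Q v) + 2 * norm v * t)" by simp
qed (auto intro!: S_generator_bound u v t)

lemma U_tendsto_id:
  assumes y: "y \<in> V"
  shows "((\<lambda>t. U t y) \<longlongrightarrow> y) (at_right 0)"
proof (rule tendstoI)
  fix e :: real assume e: "e > 0"
  obtain v where v: "v \<in> V" "norm (y - Q v) < e / 4" using dense_Q_V[OF y, of "e/4"] e by auto
  \<comment> \<open>Adding 1 keeps the divisor positive when v = 0; \<open>d\<close> then bounds the
    term proportional to t by e/2.\<close>
  define k where "k = norm v + 1"
  have k: "k > 0" by (simp add: k_def add_nonneg_pos)
  define d where "d = e / (4 * k)"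
  have d: "d > 0" using e k by (simp add: d_def)
  have "dist (U t y) y < e" if t: "0 < t" "t < d" for t
  proof -
    have "2 * norm v * t \<le> 2 * k * d" using t by (intro mult_mono) (auto simp: k_def)
    also have "\<dots> = e / 2" using k by (simp add: d_def)
    finally show ?thesis using norm_U_diff_id[OF y v(1), of t] t v(2) by (simp add: dist_norm)
  qed
  thus "\<forall>\<^sub>F t in at_right 0. dist (U t y) y < e"
    unfolding eventually_at_right_field using d by auto
qed

lemma Q_in_generator:
  assumes u: "u \<in> V"
  shows "((\<lambda>t. (1 / t) *\<^sub>R (U t (Q u) - Q u)) \<longlongrightarrow> u) (at_right 0)"
proof (rule tendstoI)
  fix e :: real assume e: "e > 0"
  obtain v where v: "v \<in> V" "norm (u - Q v) < e / 4" using dense_Q_V[OF u, of "e/4"] e by auto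
  define k where "k = norm v + 1"
  have k: "k > 0" by (simp add: k_def add_nonneg_pos)
  define d where "d = e / (4 * k)"
  have d: "d > 0" using e k by (simp add: d_def)
  have "dist ((1 / t) *\<^sub>R (U t (Q u) - Q u)) u < e" if t: "0 < t" "t < d" for t
  proof -
    have "2 * norm v * t \<le> 2 * k * d" using t by (intro mult_mono) (auto simp: k_def)
    also have "\<dots> = e / 2" using k by (simp add: d_def)
    finally have *: "2 * norm (u - Q v) + 2 * norm v * t < e" using v(2) by linarith
    have "(1 / t) *\<^sub>R (U t (Q u) - Q u) - u = (1 / t) *\<^sub>R (U t (Q u) - Q u - t *\<^sub>R u)"
      using t by (simp add: scaleR_diff_right)
    hence "norm ((1 / t) *\<^sub>R (U t (Q u) - Q u) - u) = (1 / t) * norm (U t (Q u) - Q u - t *\<^sub>R u)"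
      using t by simp
    also have "\<dots> \<le> (1 / t) * (t * (2 * norm (u - Q v) + 2 * norm v * t))"
      using t by (intro mult_left_mono U_generator_bound u v) auto
    also have "\<dots> < e" using * t by simp
    finally show ?thesis by (simp add: dist_norm)
  qed
  thus "\<forall>\<^sub>F t in at_right 0. dist ((1 / t) *\<^sub>R (U t (Q u) - Q u)) u < e"
    unfolding eventually_at_right_field using d by auto
qed

lemma C0_semigroup_U: "C0_semigroup_on V U"
proof -
  have "clinear_on V (U t) \<and> U t ` V \<subseteq> V \<and> (\<exists>K. \<forall>x\<in>V. norm (U t x) \<le> K * norm x)" if "0 \<le> t" for t
    using that U_contraction
    by (auto simp: clinear_on_def subspace_V U_add U_scaleC U_in_V intro!: exI[of _ 1])
  thus ?thesis
    unfolding C0_semigroup_on_def by (auto simp: U_zero U_semigroup U_tendsto_id)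
qed

lemma generator_U_dissipative:
  assumes z: "z \<in> V" and lim: "((\<lambda>t. (1 / t) *\<^sub>R (U t z - z)) \<longlongrightarrow> y) (at_right 0)"
  shows "Re (cinner z y) \<le> 0"
proof (rule tendsto_upperbound)
  show "((\<lambda>t. Re (cinner z ((1 / t) *\<^sub>R (U t z - z)))) \<longlongrightarrow> Re (cinner z y)) (at_right 0)"
    by (rule bounded_bilinear.tendsto[OF bounded_bilinear_Re_cinner tendsto_const lim])
  have "Re (cinner z ((1 / t) *\<^sub>R (U t z - z))) \<le> 0" if t: "0 < t" for t
  proof -
    have "norm z * norm (U t z) \<le> norm z * norm z"
      using U_contraction[OF z] t by (intro mult_left_mono) auto
    hence "Re (cinner z (U t z)) \<le> (norm z)\<^sup>2"
      using Re_cinner_le_norm[of z "U t z"] by (simp add: power2_eq_square)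
    thus ?thesis using t by (simp add: cinner_simps Re_cinner_self mult_le_0_iff divide_le_0_iff)
  qed
  thus "\<forall>\<^sub>F t in at_right 0. Re (cinner z ((1 / t) *\<^sub>R (U t z - z))) \<le> 0"
    unfolding eventually_at_right_field by (intro exI[of _ 1]) auto
qed simp

lemma generator_graph_U: "generator_graph V U = {(Q u, u) |u. u \<in> V}"
proof (intro subset_antisym subsetI)
  fix p assume "p \<in> {(Q u, u) |u. u \<in> V}"
  thus "p \<in> generator_graph V U"
    unfolding generator_graph_def using Q_in_generator Q_in_V by auto
next
  fix p assume "p \<in> generator_graph V U"
  then obtain x y where p: "p = (x, y)" and x: "x \<in> V" and y: "y \<in> V"
    and lim: "((\<lambda>t. (1 / t) *\<^sub>R (U t x - x)) \<longlongrightarrow> y) (at_right 0)"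
    unfolding generator_graph_def by auto
  \<comment> \<open>Maximality of the dissipative operator \<open>(Q u, u)\<close>: \<open>1 - Q\<close> is onto.\<close>
  obtain u where u: "u - 1 *\<^sub>R Q u = y - x" using shift_surj[of 1 "y - x"] w_pos by auto
  hence "u = Q u + (y - x)" by (simp add: algebra_simps)
  hence uV: "u \<in> V" by (metis V_add Q_in_V V_diff x y)
  have eq: "y - u = x - Q u" using u by (simp add: algebra_simps)
  \<comment> \<open>Subtracting the two pairs makes \<open>x - Q u\<close> an eigenvector of the
    generator for the eigenvalue 1, unless it is 0; dissipativity excludes the eigenvector.\<close>
  have "((\<lambda>t. (1 / t) *\<^sub>R (U t x - x) - (1 / t) *\<^sub>R (U t (Q u) - Q u)) \<longlongrightarrow> y - u) (at_right 0)"
    by (rule tendsto_diff[OF lim Q_in_generator[OF uV]])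
  hence "((\<lambda>t. (1 / t) *\<^sub>R (U t (x - Q u) - (x - Q u))) \<longlongrightarrow> x - Q u) (at_right 0)"
    unfolding eq
  proof (rule Lim_transform_eventually)
    have diff: "U t (x - Q u) = U t x - U t (Q u)" if "0 \<le> t" for t
      using U_add[OF V_diff[OF x Q_in_V] Q_in_V that, of u u] by (simp add: algebra_simps)
    show "\<forall>\<^sub>F t in at_right 0. (1 / t) *\<^sub>R (U t x - x) - (1 / t) *\<^sub>R (U t (Q u) - Q u) =
      (1 / t) *\<^sub>R (U t (x - Q u) - (x - Q u))"
      unfolding eventually_at_right_field
      by (intro exI[of _ 1]) (auto simp: diff scaleR_diff_right)
  qed
  from generator_U_dissipative[OF V_diff[OF x Q_in_V] this]
  have "x = Q u" by (simp add: Re_cinner_self)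
  with eq have "y = u" by simp
  thus "p \<in> {(Q u, u) |u. u \<in> V}" using p \<open>x = Q u\<close> uV by blast
qed

section \<open>Decay of every semigroup with the given generator\<close>

context
  fixes W :: "real \<Rightarrow> 'a \<Rightarrow> 'a"
  assumes C0: "C0_semigroup_on V W"
begin

lemma W_clinear: "0 \<le> t \<Longrightarrow> clinear_on V (W t)"
  and W_in_V: "0 \<le> t \<Longrightarrow> x \<in> V \<Longrightarrow> W t x \<in> V"
  and W_bounded: "0 \<le> t \<Longrightarrow> \<exists>K. \<forall>x\<in>V. norm (W t x) \<le> K * norm x"
  and W_zero: "x \<in> V \<Longrightarrow> W 0 x = x"
  and W_semigroup: "0 \<le> s \<Longrightarrow> 0 \<le> t \<Longrightarrow> x \<in> V \<Longrightarrow> W (s + t) x = W s (W t x)"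
  and W_tendsto_id: "x \<in> V \<Longrightarrow> ((\<lambda>t. W t x) \<longlongrightarrow> x) (at_right 0)"
  using C0 unfolding C0_semigroup_on_def image_subset_iff by blast+

lemma W_add: "0 \<le> t \<Longrightarrow> x \<in> V \<Longrightarrow> y \<in> V \<Longrightarrow> W t (x + y) = W t x + W t y"
  and W_scaleC: "0 \<le> t \<Longrightarrow> x \<in> V \<Longrightarrow> W t (c *\<^sub>C x) = c *\<^sub>C W t x"
  using W_clinear by (simp_all add: clinear_on_def)

lemma W_scaleR: "0 \<le> t \<Longrightarrow> x \<in> V \<Longrightarrow> W t (r *\<^sub>R x) = r *\<^sub>R W t x"
  by (simp add: scaleR_scaleC W_scaleC)

lemma W_diff: "0 \<le> t \<Longrightarrow> x \<in> V \<Longrightarrow> y \<in> V \<Longrightarrow> W t (x - y) = W t x - W t y"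
  using W_add[of t "x - y" y] by (simp add: V_diff)

text \<open>The uniform boundedness principle above concerns operators on a whole Banach space;
  composing with the contraction P extends \<open>W t\<close> from V without changing it
  there.\<close>

lemma bounded_linear_W_P:
  assumes "0 \<le> t"
  shows "bounded_linear (\<lambda>x. W t (P x))"
proof -
  obtain K where K: "\<And>x. x \<in> V \<Longrightarrow> norm (W t x) \<le> K * norm x"
    using W_bounded[OF assms] by blast
  have "norm (W t (P x)) \<le> \<bar>K\<bar> * norm x" for x
  proof -
    have "norm (W t (P x)) \<le> K * norm (P x)" by (rule K[OF P(1)])
    also have "\<dots> \<le> \<bar>K\<bar> * norm x" using norm_P_le[of x] by (intro mult_mono) auto
    finally show ?thesis .
  qed
  hence "bounded_clinear (\<lambda>x. W t (P x))"
    by (intro bounded_clinearI[where C = "\<bar>K\<bar>"])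
      (simp_all add: P_add P_scaleC W_add W_scaleC P(1) assms)
  thus ?thesis by (rule bounded_clinear_bounded_linear)
qed

text \<open>Otherwise some times t_n -> 0 carry operator norms above n + 1, while strong continuity
  makes the orbits of each fixed vector bounded along t_n.\<close>

lemma W_bounded_near_zero: "\<exists>d>0. \<exists>C. \<forall>t\<in>{0..d}. \<forall>x\<in>V. norm (W t x) \<le> C * norm x"
proof (rule ccontr)
  assume neg: "\<not> ?thesis"
  have "\<exists>t x. 0 \<le> t \<and> t \<le> inverse (real (Suc n)) \<and> x \<in> V \<and> real (Suc n) * norm x < norm (W t x)" for n
  proof -
    have "\<not> (\<forall>t\<in>{0..inverse (real (Suc n))}. \<forall>x\<in>V. norm (W t x) \<le> real (Suc n) * norm x)"
      using neg positive_imp_inverse_positive[of "real (Suc n)"] by (meson of_nat_0_less_iff zero_less_Suc)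
    thus ?thesis by (auto simp: not_le simp del: of_nat_Suc)
  qed
  then obtain t x where t0: "\<And>n. 0 \<le> t n" and t1: "\<And>n. t n \<le> inverse (real (Suc n))"
    and x: "\<And>n. x n \<in> V" and big: "\<And>n. real (Suc n) * norm (x n) < norm (W (t n) (x n))"
    by metis
  \<comment> \<open>The time 0 cannot occur, because the identity does not exceed the factor
    \<open>Suc n\<close>; the limit from the right therefore applies.\<close>
  have pos: "0 < t n" for n
  proof -
    have "1 * norm (x n) \<le> real (Suc n) * norm (x n)" by (intro mult_right_mono) auto
    hence "t n \<noteq> 0" using big[of n] W_zero[OF x[of n]] by auto
    thus ?thesis using t0[of n] by simp
  qed
  have "t \<longlonglongrightarrow> 0"
    by (rule tendsto_sandwich[OF _ _ tendsto_const LIMSEQ_inverse_real_of_nat]) (use t0 t1 in auto)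
  hence t_lim: "filterlim t (at_right 0) sequentially"
    by (rule tendsto_imp_filterlim_at_right) (use pos in auto)
  have "\<exists>b. \<forall>n. norm (W (t n) (P y)) \<le> b" for y
  proof -
    have "(\<lambda>n. W (t n) (P y)) \<longlonglongrightarrow> P y"
      by (rule filterlim_compose[OF W_tendsto_id[OF P(1)] t_lim])
    hence "Bseq (\<lambda>n. W (t n) (P y))" by (rule convergent_imp_Bseq[OF convergentI])
    thus ?thesis by (auto simp: Bseq_def)
  qed
  from uniform_boundedness[OF bounded_linear_W_P[OF t0] this]
  obtain C where C: "\<And>n y. norm (W (t n) (P y)) \<le> C * norm y" by blast
  obtain n where n: "C \<le> real n" using real_arch_simple by blast
  have "P (x n) = x n" using P_eq[of 0 "x n"] x by (simp add: Q_simps)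
  hence "norm (W (t n) (x n)) \<le> C * norm (x n)" using C[of n "x n"] by simp
  also have "\<dots> \<le> real (Suc n) * norm (x n)" using n by (intro mult_right_mono) auto
  finally show False using big[of n] by simp
qed

lemma W_locally_bounded:
  obtains C where "0 \<le> C" "\<And>t x. 0 \<le> t \<Longrightarrow> t \<le> a \<Longrightarrow> x \<in> V \<Longrightarrow> norm (W t x) \<le> C * norm x"
proof -
  obtain d C where d: "d > 0" and "\<forall>t\<in>{0..d}. \<forall>x\<in>V. norm (W t x) \<le> C * norm x"
    using W_bounded_near_zero by blast
  hence C: "norm (W t x) \<le> C * norm x" if "0 \<le> t" "t \<le> d" "x \<in> V" for t x
    using that by simp
  \<comment> \<open>A constant of at least 1 has increasing powers, so the power for the longest
    time also serves all shorter ones.\<close>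
  have C': "norm (W t x) \<le> max 1 C * norm x" if "0 \<le> t" "t \<le> d" "x \<in> V" for t x
    using order_trans[OF C[OF that] mult_right_mono[OF max.cobounded2]] by simp
  have step: "norm (W t x) \<le> max 1 C ^ Suc n * norm x" if "0 \<le> t" "t \<le> real (Suc n) * d" "x \<in> V" for n t x
    using that
  proof (induction n arbitrary: t)
    case 0
    thus ?case using C'[of t x] by simp
  next
    case (Suc n)
    show ?case
    proof (cases "t \<le> d")
      case True
      have "norm (W t x) \<le> max 1 C * norm x" by (rule C'[OF Suc.prems(1) True Suc.prems(3)])
      also have "\<dots> \<le> max 1 C ^ Suc (Suc n) * norm x"
        using power_increasing[of 1 "Suc (Suc n)" "max 1 C"] by (intro mult_right_mono) auto
      finally show ?thesis .
    next
      case False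
      hence le: "0 \<le> t - d" "t - d \<le> real (Suc n) * d" using Suc.prems by (auto simp: algebra_simps)
      have "W t x = W d (W (t - d) x)" using W_semigroup[of d "t - d" x] d le Suc.prems(3) by simp
      also have "norm \<dots> \<le> max 1 C * norm (W (t - d) x)"
        using d le Suc.prems by (intro C' W_in_V) auto
      also have "\<dots> \<le> max 1 C * (max 1 C ^ Suc n * norm x)"
        by (intro mult_left_mono Suc.IH le Suc.prems) auto
      finally show ?thesis by (simp add: mult.assoc)
    qed
  qed
  obtain n where "a / d \<le> real n" using real_arch_simple by blast
  hence "a \<le> real (Suc n) * d" using d by (simp add: field_simps)
  thus ?thesis using step[of _ n] by (intro that[of "max 1 C ^ Suc n"]) auto
qed

text \<open>\<open>W t\<close> commutes with the difference quotients of the semigroup and is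
  continuous on V, so it can be applied to the limit; P again supplies an operator on the whole
  space.\<close>

lemma W_generator_invariant:
  assumes x: "x \<in> V" and y: "y \<in> V" and t: "0 \<le> t"
    and lim: "((\<lambda>h. (1 / h) *\<^sub>R (W h x - x)) \<longlongrightarrow> y) (at_right 0)"
  shows "((\<lambda>h. (1 / h) *\<^sub>R (W h (W t x) - W t x)) \<longlongrightarrow> W t y) (at_right 0)"
proof -
  have PV: "P v = v" if "v \<in> V" for v using P_eq[of 0 v] that by (simp add: Q_simps)
  have lim': "((\<lambda>h. W t (P ((1 / h) *\<^sub>R (W h x - x)))) \<longlongrightarrow> W t y) (at_right 0)"
    using bounded_linear.tendsto[OF bounded_linear_W_P[OF t] lim] by (simp only: PV[OF y])
  have "W t (P ((1 / h) *\<^sub>R (W h x - x))) = (1 / h) *\<^sub>R (W h (W t x) - W t x)" if h: "0 < h" for h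
  proof -
    have "W t (W h x) = W h (W t x)"
      using W_semigroup[of t h x] W_semigroup[of h t x] h t x by (simp add: add.commute)
    thus ?thesis using h t x by (simp add: PV V_scaleR V_diff W_in_V W_scaleR W_diff)
  qed
  hence "\<forall>\<^sub>F h in at_right 0. W t (P ((1 / h) *\<^sub>R (W h x - x))) = (1 / h) *\<^sub>R (W h (W t x) - W t x)"
    unfolding eventually_at_right_field by (intro exI[of _ 1]) auto
  thus ?thesis by (rule Lim_transform_eventually[OF lim'])
qed

text \<open>The difference quotient from the right is \<open>W t\<close> applied to the one at 0.
  From the left the base point s varies, so local boundedness is needed to control
  \<open>W s\<close> uniformly.\<close>

lemma W_has_derivative:
  assumes x: "x \<in> V" and y: "y \<in> V" and t: "0 \<le> t"
    and lim: "((\<lambda>h. (1 / h) *\<^sub>R (W h x - x)) \<longlongrightarrow> y) (at_right 0)"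
  shows "((\<lambda>t. W t x) has_vector_derivative W t y) (at t within {0..})"
  unfolding has_vector_derivative_def has_derivative_within_alt
proof (intro conjI allI impI)
  show "bounded_linear (\<lambda>h. h *\<^sub>R W t y)" by (rule bounded_linear_scaleR_left)
  fix e :: real assume e: "e > 0"
  obtain C where C0: "0 \<le> C" and C: "\<And>s x. 0 \<le> s \<Longrightarrow> s \<le> t \<Longrightarrow> x \<in> V \<Longrightarrow> norm (W s x) \<le> C * norm x"
    using W_locally_bounded[of t] by blast
  \<comment> \<open>The left-hand estimate has two errors, each at most C c h, so C c <= e/2 is
    required; \<open>C + 1\<close> avoids dividing by 0.\<close>
  define c where "c = e / (2 * (C + 1))"
  have c: "c > 0" using e C0 by (simp add: c_def)
  have "C * c \<le> (C + 1) * c" using c by simp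
  also have "(C + 1) * c = e / 2" using C0 unfolding c_def by (simp add: divide_simps)
  finally have Cc: "C * c \<le> e / 2" .
  obtain d1 where d1: "d1 > 0" "\<And>h. 0 < h \<Longrightarrow> h < d1 \<Longrightarrow> norm ((1 / h) *\<^sub>R (W h x - x) - y) < c"
    using tendstoD[OF lim c] unfolding eventually_at_right_field dist_norm by auto
  obtain d2 where d2: "d2 > 0" "\<And>h. 0 < h \<Longrightarrow> h < d2 \<Longrightarrow> norm (W h y - y) < c"
    using tendstoD[OF W_tendsto_id[OF y] c] unfolding eventually_at_right_field dist_norm by auto
  have b1: "norm (W h x - x - h *\<^sub>R y) \<le> c * h" if h: "0 < h" "h < d1" for h
  proof -
    have "W h x - x - h *\<^sub>R y = h *\<^sub>R ((1 / h) *\<^sub>R (W h x - x) - y)" using h by (simp add: scaleR_diff_right)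
    thus ?thesis using d1(2)[OF h] h by (simp add: mult.commute)
  qed
  have mem: "W h x - x - h *\<^sub>R y \<in> V" if "0 \<le> h" for h
    using that by (intro V_diff W_in_V V_scaleR x y)
  have "norm (W s x - W t x - (s - t) *\<^sub>R W t y) \<le> e * norm (s - t)"
    if s: "0 \<le> s" "norm (s - t) < min d1 d2" for s
  proof -
    consider "s = t" | "t < s" | "s < t" by linarith
    thus ?thesis
    proof cases
      case 2
      define h where "h = s - t"
      have h: "0 < h" "h < d1" "s = t + h" using 2 s by (auto simp: h_def)
      have "W s x - W t x - h *\<^sub>R W t y = W t (W h x - x - h *\<^sub>R y)"
        using h t x y by (simp add: W_semigroup W_diff W_scaleR W_in_V V_diff V_scaleR)
      also have "norm \<dots> \<le> C * norm (W h x - x - h *\<^sub>R y)"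
        using h t by (intro C mem) auto
      also have "\<dots> \<le> C * (c * h)" by (intro mult_left_mono b1 h C0)
      also have "\<dots> \<le> e * h" using mult_right_mono[OF Cc, of h] h e by (simp add: mult.assoc)
      finally have "norm (W s x - W t x - h *\<^sub>R W t y) \<le> e * h" .
      thus ?thesis using h(1) by (simp add: h_def)
    next
      case 3
      define h where "h = t - s"
      have h: "0 < h" "h < d1" "h < d2" "t = s + h" using 3 s by (auto simp: h_def)
      have "W s x - W t x + h *\<^sub>R W t y = h *\<^sub>R W s (W h y - y) - W s (W h x - x - h *\<^sub>R y)"
        using h s(1) x y
        by (simp add: W_semigroup W_diff W_scaleR W_in_V V_diff V_scaleR scaleR_diff_right)
      also have "norm \<dots> \<le> h * norm (W s (W h y - y)) + norm (W s (W h x - x - h *\<^sub>R y))"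
        using norm_triangle_ineq4[of "h *\<^sub>R W s (W h y - y)" "W s (W h x - x - h *\<^sub>R y)"] h(1) by simp
      also have "\<dots> \<le> h * (C * norm (W h y - y)) + C * norm (W h x - x - h *\<^sub>R y)"
        using h s(1) 3 y by (intro add_mono mult_left_mono C mem V_diff W_in_V) auto
      also have "\<dots> \<le> h * (C * c) + C * (c * h)"
        using h d2(2)[of h] by (intro add_mono mult_left_mono b1 C0) auto
      also have "\<dots> = 2 * (C * c) * h" by simp
      also have "\<dots> \<le> e * h" using Cc h by (intro mult_right_mono) auto
      finally have "norm (W s x - W t x + h *\<^sub>R W t y) \<le> e * h" .
      moreover have "s - t = - h" by (simp add: h_def)
      ultimately show ?thesis using h(1) by simp
    qed simp
  qed
  thus "\<exists>d>0. \<forall>s\<in>{0..}. norm (s - t) < d \<longrightarrow>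
      norm (W s x - W t x - (s - t) *\<^sub>R W t y) \<le> e * norm (s - t)"
    using d1(1) d2(1) by (intro exI[of _ "min d1 d2"]) auto
qed

text \<open>An orbit starting in the domain of the generator stays there and is differentiable, so
  dissipativity gives the decay; local boundedness and density carry it to all of V.\<close>

lemma W_decay:
  assumes gen: "generator_graph V W = {(Q u, u) |u. u \<in> V}" and x: "x \<in> V" and t: "0 \<le> t"
  shows "norm (W t x) \<le> exp (- w * t) * norm x"
proof -
  have dom: "norm (W t (Q u)) \<le> exp (- w * t) * norm (Q u)" if u: "u \<in> V" for u
  proof -
    have "(Q u, u) \<in> generator_graph V W" unfolding gen using u by blast
    hence lim: "((\<lambda>h. (1 / h) *\<^sub>R (W h (Q u) - Q u)) \<longlongrightarrow> u) (at_right 0)"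
      unfolding generator_graph_def by blast
    have "norm (W t (Q u)) \<le> exp (- w * t) * norm (W 0 (Q u))"
    proof (rule dissipative_decay[OF _ _ t])
      fix s :: real assume s: "0 \<le> s"
      show "((\<lambda>t. W t (Q u)) has_vector_derivative W s u) (at s within {0..})"
        by (rule W_has_derivative[OF Q_in_V u s lim])
      have "(W s (Q u), W s u) \<in> generator_graph V W"
        using W_generator_invariant[OF Q_in_V u s lim] W_in_V[OF s] Q_in_V u
        unfolding generator_graph_def by blast
      \<comment> \<open>Membership in the known graph identifies the first component as Q of the
        second, so the inequality for Q becomes the energy inequality along the orbit.\<close>
      hence "W s (Q u) = Q (W s u)" unfolding gen by blast
      thus "Re (cinner (W s (Q u)) (W s u)) \<le> - w * (norm (W s (Q u)))\<^sup>2"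
        using diss[of "W s u"] by (simp add: Re_cinner_commute)
    qed
    thus ?thesis by (simp add: W_zero Q_in_V)
  qed
  obtain C where C: "0 \<le> C" "\<And>y. y \<in> V \<Longrightarrow> norm (W t y) \<le> C * norm y"
    using W_locally_bounded[of t] t by (metis order_refl)
  show ?thesis
  proof (rule field_le_epsilon)
    fix e :: real assume e: "e > 0"
    obtain v where v: "v \<in> V" "norm (x - Q v) < e / (C + 1)"
      using dense_Q_V[OF x, of "e / (C + 1)"] e C(1) by auto
    have "norm (W t x) = norm (W t (x - Q v) + W t (Q v))"
      by (simp add: W_diff x t Q_in_V)
    also have "\<dots> \<le> norm (W t (x - Q v)) + norm (W t (Q v))" by (rule norm_triangle_ineq)
    also have "\<dots> \<le> C * norm (x - Q v) + exp (- w * t) * norm (Q v)"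
      by (intro add_mono C dom v V_diff x Q_in_V)
    also have "\<dots> \<le> C * norm (x - Q v) + (exp (- w * t) * norm x + norm (x - Q v))"
    proof -
      have "norm (Q v) \<le> norm x + norm (x - Q v)"
        using norm_triangle_ineq4[of x "x - Q v"] by simp
      hence "exp (- w * t) * norm (Q v) \<le> exp (- w * t) * (norm x + norm (x - Q v))"
        by (rule mult_left_mono) simp
      also have "\<dots> \<le> exp (- w * t) * norm x + 1 * norm (x - Q v)"
        unfolding distrib_left using w_pos t by (intro add_left_mono mult_right_mono) auto
      finally show ?thesis by simp
    qed
    also have "\<dots> = exp (- w * t) * norm x + (C + 1) * norm (x - Q v)" by (simp add: algebra_simps)
    also have "\<dots> \<le> exp (- w * t) * norm x + e"
      using v(2) C(1) by (simp add: pos_less_divide_eq mult.commute less_imp_le)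
    finally show "norm (W t x) \<le> exp (- w * t) * norm x + e" .
  qed
qed

end

section \<open>Degenerate semigroups\<close>

text \<open>With a = v + l R v the equation says Q a = R v and a - l Q a = v. Thus
  \<open>shift_bound\<close> is the norm bound, and uniqueness of the solution yields linearity of
  R, which is not presupposed.\<close>

lemma resolvent_bounded:
  assumes l: "l > - w" and R: "\<And>v. R v = Q (v + l *\<^sub>R R v)"
  shows "bounded_clinear R" and "onorm R \<le> inverse (l + w)"
proof -
  have R_eqI: "R v = y" if "y = Q (v + l *\<^sub>R y)" for v y
  proof -
    have "Q v = y - l *\<^sub>R Q y" using that by (metis Q_simps(1,5) add_diff_cancel_right')
    moreover have "Q v = R v - l *\<^sub>R Q (R v)" using R[of v] by (metis Q_simps(1,5) add_diff_cancel_right')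
    ultimately show ?thesis using shift_inj[OF l] by metis
  qed
  have bound: "norm (R v) \<le> inverse (l + w) * norm v" for v
  proof -
    define a where "a = v + l *\<^sub>R R v"
    have "R v = Q a" unfolding a_def by (rule R)
    hence "a - l *\<^sub>R Q a = v" by (simp add: a_def)
    hence "(l + w) * norm (R v) \<le> norm v" using shift_bound[of l a] \<open>R v = Q a\<close> by metis
    thus ?thesis using l by (simp add: field_simps)
  qed
  show "bounded_clinear R"
  proof (rule bounded_clinearI[OF _ _ bound])
    show "R (x + y) = R x + R y" for x y
    proof (rule R_eqI)
      have "Q (x + y + l *\<^sub>R (R x + R y)) = Q (x + l *\<^sub>R R x) + Q (y + l *\<^sub>R R y)"
        by (simp add: Q_simps algebra_simps)
      thus "R x + R y = Q (x + y + l *\<^sub>R (R x + R y))" by (simp only: R[symmetric])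
    qed
    show "R (c *\<^sub>C x) = c *\<^sub>C R x" for c x
    proof (rule R_eqI)
      have "c *\<^sub>C x + l *\<^sub>R (c *\<^sub>C R x) = c *\<^sub>C (x + l *\<^sub>R R x)"
        by (simp add: scaleC_add_right scaleR_scaleC scaleC_scaleC mult.commute)
      thus "c *\<^sub>C R x = Q (c *\<^sub>C x + l *\<^sub>R (c *\<^sub>C R x))"
        by (simp only: scaleC R[symmetric])
    qed
  qed
  show "onorm R \<le> inverse (l + w)" by (rule onorm_bound[OF _ bound]) (use l in simp)
qed

section \<open>Pseudo-resolvents expressed through Q\<close>

context
  fixes \<Lambda> :: "complex set" and R :: "complex \<Rightarrow> 'a \<Rightarrow> 'a"
  assumes R: "\<And>\<mu> v y. \<mu> \<in> \<Lambda> \<Longrightarrow> R \<mu> v = y \<longleftrightarrow> y = Q (v + \<mu> *\<^sub>C y)"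
begin

lemma resolvent_kernel: "\<mu> \<in> \<Lambda> \<Longrightarrow> {x. R \<mu> x = 0} = {x. Q x = 0}"
  by (simp add: R)

lemma resolvent_range:
  assumes "\<mu> \<in> \<Lambda>"
  shows "closure (range (R \<mu>)) = V"
proof -
  have "R \<mu> v \<in> range Q" for v using R[OF assms, of v "R \<mu> v"] by auto
  moreover have "Q u \<in> range (R \<mu>)" for u
    using R[OF assms, of "u - \<mu> *\<^sub>C Q u" "Q u"] by (metis diff_add_cancel rangeI)
  ultimately have "range (R \<mu>) = range Q" by blast
  thus ?thesis by (simp add: V_def)
qed

text \<open>The substitution u = x + mu R(mu) x, with inverse x = u - mu Q u, preserves V.\<close>

lemma resolvent_graph:
  assumes "\<mu> \<in> \<Lambda>"
  shows "{(R \<mu> x, x + \<mu> *\<^sub>C R \<mu> x) |x. x \<in> V} = {(Q u, u) |u. u \<in> V}"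
proof (intro subset_antisym subsetI)
  fix p assume "p \<in> {(R \<mu> x, x + \<mu> *\<^sub>C R \<mu> x) |x. x \<in> V}"
  then obtain x where x: "x \<in> V" "p = (R \<mu> x, x + \<mu> *\<^sub>C R \<mu> x)" by blast
  have eq: "R \<mu> x = Q (x + \<mu> *\<^sub>C R \<mu> x)" using R[OF assms, of x "R \<mu> x"] by simp
  hence "R \<mu> x \<in> V" by (metis Q_in_V)
  hence "x + \<mu> *\<^sub>C R \<mu> x \<in> V" by (intro V_add V_scaleC x)
  moreover have "p = (Q (x + \<mu> *\<^sub>C R \<mu> x), x + \<mu> *\<^sub>C R \<mu> x)" using x(2) eq by metis
  ultimately show "p \<in> {(Q u, u) |u. u \<in> V}" by blast
next
  fix p assume "p \<in> {(Q u, u) |u. u \<in> V}"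
  then obtain u where u: "u \<in> V" "p = (Q u, u)" by blast
  define x where "x = u - \<mu> *\<^sub>C Q u"
  have "x \<in> V" unfolding x_def by (intro V_diff V_scaleC Q_in_V u)
  moreover have "R \<mu> x = Q u" using R[OF assms, of x "Q u"] by (simp add: x_def)
  hence "p = (R \<mu> x, x + \<mu> *\<^sub>C R \<mu> x)" using u(2) by (simp add: x_def)
  ultimately show "p \<in> {(R \<mu> x, x + \<mu> *\<^sub>C R \<mu> x) |x. x \<in> V}" by blast
qed

lemma degenerate_semigroup_exists:
  assumes "complex_of_real ` {- w<..} \<subseteq> \<Lambda>"
  shows "degenerate_semigroup \<Lambda> R (\<lambda>t x. U t (P x))"
proof -
  have "complex_of_real \<mu> \<in> \<Lambda> \<and> bounded_clinear (R (complex_of_real \<mu>)) \<and>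
      onorm (R (complex_of_real \<mu>)) \<le> 1 / (\<mu> - (- w))" if \<mu>: "\<mu> > - w" for \<mu>
  proof -
    have mem: "complex_of_real \<mu> \<in> \<Lambda>" using assms \<mu> by auto
    have "R (complex_of_real \<mu>) v = Q (v + \<mu> *\<^sub>R R (complex_of_real \<mu>) v)" for v
      using R[OF mem, of v "R (complex_of_real \<mu>) v"] by (simp add: scaleR_scaleC)
    from resolvent_bounded[OF \<mu> this] mem show ?thesis by (simp add: inverse_eq_divide)
  qed
  hence 1: "\<exists>M>0. \<exists>\<omega>\<^sub>0. \<forall>\<mu>>\<omega>\<^sub>0. complex_of_real \<mu> \<in> \<Lambda> \<and>
       bounded_clinear (R (complex_of_real \<mu>)) \<and> onorm (R (complex_of_real \<mu>)) \<le> M / (\<mu> - \<omega>\<^sub>0)"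
    by (intro exI[of _ "1::real"] conjI[OF zero_less_one] exI[of _ "- w"] allI impI)
  show ?thesis
    unfolding degenerate_semigroup_def
  proof (rule conjI[OF 1], intro exI conjI)
    show "\<forall>\<mu>\<in>\<Lambda>. {x. Q x = 0} = {x. R \<mu> x = 0} \<and> V = closure (range (R \<mu>)) \<and>
        {(Q u, u) |u. u \<in> V} = {(R \<mu> x, x + \<mu> *\<^sub>C R \<mu> x) |x. x \<in> V}"
      by (intro ballI conjI resolvent_kernel[symmetric] resolvent_range[symmetric] resolvent_graph[symmetric])
    show "closed_direct_sum {x. Q x = 0} V" by (rule closed_direct_sum_kernel_V)
    show "C0_semigroup_on V U" by (rule C0_semigroup_U)
    show "generator_graph V U = {(Q u, u) |u. u \<in> V}" by (rule generator_graph_U)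
    show "\<forall>t\<ge>0. \<forall>x\<^sub>0\<in>{x. Q x = 0}. \<forall>x\<^sub>1\<in>V. U t (P (x\<^sub>0 + x\<^sub>1)) = U t x\<^sub>1"
      by (simp add: P_eq)
  qed
qed

lemma degenerate_semigroup_stable:
  assumes "degenerate_semigroup \<Lambda> R T"
  shows "exponentially_stable T"
proof -
  \<comment> \<open>A single point of the resolvent set pins down kernel, closed range and generator
    graph; without one the quantifier over it would say nothing.\<close>
  have "\<exists>\<mu>. \<mu> \<in> \<Lambda>"
    using assms unfolding degenerate_semigroup_def by (metis gt_ex)
  then obtain \<mu> where \<mu>: "\<mu> \<in> \<Lambda>" by blast
  obtain X\<^sub>K X\<^sub>R G\<^sub>R W where X: "\<forall>\<mu>\<in>\<Lambda>. X\<^sub>K = {x. R \<mu> x = 0} \<and> X\<^sub>R = closure (range (R \<mu>)) \<and>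
        G\<^sub>R = {(R \<mu> x, x + \<mu> *\<^sub>C R \<mu> x) |x. x \<in> X\<^sub>R}"
    and C0: "C0_semigroup_on X\<^sub>R W" and gen: "generator_graph X\<^sub>R W = G\<^sub>R"
    and T: "\<forall>t\<ge>0. \<forall>x\<^sub>0\<in>X\<^sub>K. \<forall>x\<^sub>1\<in>X\<^sub>R. T t (x\<^sub>0 + x\<^sub>1) = W t x\<^sub>1"
    using assms[unfolded degenerate_semigroup_def, THEN conjunct2]
    by (elim exE conjE) (rule that; assumption)
  note X\<mu> = bspec[OF X \<mu>]
  have XK: "X\<^sub>K = {x. Q x = 0}"
    using conjunct1[OF X\<mu>] resolvent_kernel[OF \<mu>] by (rule trans)
  have XR: "X\<^sub>R = V"
    using conjunct1[OF conjunct2[OF X\<mu>]] resolvent_range[OF \<mu>] by (rule trans)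
  have "G\<^sub>R = {(Q u, u) |u. u \<in> V}"
    using conjunct2[OF conjunct2[OF X\<mu>]] resolvent_graph[OF \<mu>] unfolding XR by (rule trans)
  hence gen: "generator_graph V W = {(Q u, u) |u. u \<in> V}" using gen XR by simp
  have C0: "C0_semigroup_on V W" using C0 XR by simp
  \<comment> \<open>The decomposition of x into kernel and V components recovers T from its
    semigroup on V at every vector.\<close>
  have TW: "T t x = W t (P x)" if "0 \<le> t" for t x
  proof -
    have "T t ((x - P x) + P x) = W t (P x)"
      using T that P[of x] unfolding XK XR by blast
    thus ?thesis by simp
  qed
  have bound: "norm (T t x) \<le> exp (- w * t) * norm x" if t: "0 \<le> t" for t x
  proof -
    have "norm (W t (P x)) \<le> exp (- w * t) * norm (P x)" by (rule W_decay[OF C0 gen P(1) t])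
    also have "\<dots> \<le> exp (- w * t) * norm x" by (intro mult_left_mono norm_P_le) simp
    finally show ?thesis by (simp add: TW t)
  qed
  have "bounded_clinear (T t) \<and> onorm (T t) \<le> 1 * exp (- w * t)" if t: "0 \<le> t" for t
  proof
    show "bounded_clinear (T t)"
      by (rule bounded_clinearI[OF _ _ bound[OF t]])
        (simp_all add: TW t P_add P_scaleC W_add[OF C0] W_scaleC[OF C0] P(1))
    show "onorm (T t) \<le> 1 * exp (- w * t)" using onorm_bound[OF _ bound[OF t]] by simp
  qed
  thus ?thesis unfolding exponentially_stable_def using w_pos
    by (intro exI[of _ 1] conjI exI[of _ w]) auto
qed

end

end

section \<open>The operator pair\<close>

text \<open>On D the operator l E - A is A followed by 1 - l E B and a sign change, all bijective.
  Keeping B an abstract left inverse lets the result serve the adjoint pair as well.\<close>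

lemma of_real_in_resolvent_set:
  fixes A :: "'x::complex_inner \<Rightarrow> 'z::complex_hilbert"
  assumes diss: "inverse_dissipative (E \<circ> B) w" and A: "bij_betw A D UNIV"
    and BA: "\<And>x. x \<in> D \<Longrightarrow> B (A x) = x" and l: "l > - w"
  shows "complex_of_real l \<in> resolvent_set E D A"
proof -
  interpret inverse_dissipative "E \<circ> B" w by (rule diss)
  have "bij (uminus \<circ> (\<lambda>z. z - l *\<^sub>R (E \<circ> B) z))"
    by (rule bij_comp[OF shift_bij[OF l] bij_uminus])
  hence "bij_betw ((uminus \<circ> (\<lambda>z. z - l *\<^sub>R (E \<circ> B) z)) \<circ> A) D UNIV"
    by (rule bij_betw_trans[OF A])
  moreover have "((uminus \<circ> (\<lambda>z. z - l *\<^sub>R (E \<circ> B) z)) \<circ> A) x = complex_of_real l *\<^sub>C E x - A x"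
    if "x \<in> D" for x
    using BA[OF that] by (simp add: scaleR_scaleC)
  ultimately show ?thesis
    unfolding resolvent_set_def mem_Collect_eq using bij_betw_cong by (metis (no_types, lifting))
qed

locale dissipative_pair =
  fixes E :: "'x::complex_hilbert \<Rightarrow> 'z::complex_hilbert"
    and D :: "'x set" and A :: "'x \<Rightarrow> 'z" and w :: real
  assumes E: "bounded_clinear E"
    and A_clinear: "clinear_on D A" and A_closed: "closed_op D A" and D_dense: "densely_defined D"
    and A_bij: "bij_betw A D UNIV"
    and w_pos: "w > 0"
    and diss: "x \<in> D \<Longrightarrow> Re (cinner (A x) (E x)) \<le> - w * (norm (E x))\<^sup>2"
    and adj_diss: "y \<in> adj_dom D A \<Longrightarrow>
           Re (cinner (adj D A y) (adj UNIV E y)) \<le> - w * (norm (adj UNIV E y))\<^sup>2"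
begin

definition B :: "'z \<Rightarrow> 'x" where "B = inv_into D A"

lemma B_in_D: "B z \<in> D" and A_B: "A (B z) = z"
  unfolding B_def using A_bij by (auto simp: bij_betw_def inv_into_into f_inv_into_f)

lemma B_A: "x \<in> D \<Longrightarrow> B (A x) = x"
  unfolding B_def using A_bij by (simp add: bij_betw_def)

lemma A_add: "x \<in> D \<Longrightarrow> y \<in> D \<Longrightarrow> A (x + y) = A x + A y"
  and A_scaleC: "x \<in> D \<Longrightarrow> A (c *\<^sub>C x) = c *\<^sub>C A x"
  and subspace_D: "complex_vector.subspace D"
  using A_clinear by (simp_all add: clinear_on_def)

lemma B_add: "B (x + y) = B x + B y"
  by (metis A_B A_add B_A B_in_D complex_vector.subspace_add subspace_D)

lemma B_scaleC: "B (c *\<^sub>C x) = c *\<^sub>C B x"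
  by (metis A_B A_scaleC B_A B_in_D complex_vector.subspace_scale subspace_D)

lemma bounded_clinear_B: "bounded_clinear B"
proof -
  have "{(z, B z) |z. True} = prod.swap -` op_graph D A"
    by (auto simp: op_graph_def A_B B_in_D B_A)
  moreover have "closed (prod.swap -` op_graph D A)"
    using A_closed unfolding closed_op_def
    by (intro closed_vimage continuous_on_swap)
  ultimately have "bounded_linear B"
    by (intro closed_graph_bounded_linear linearI) (simp_all add: B_add scaleR_scaleC B_scaleC)
  thus ?thesis by (simp add: bounded_clinear_def B_scaleC)
qed

section \<open>The adjoint pair and the three dissipative operators\<close>

abbreviation "E' \<equiv> adj UNIV E"
abbreviation "B' \<equiv> adj UNIV B"
abbreviation "A' \<equiv> adj D A"
abbreviation "D' \<equiv> adj_dom D A"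

lemma A_B': "x \<in> D \<Longrightarrow> cinner (A x) (B' z) = cinner x z"
  using cinner_adj[OF bounded_clinear_B, of "A x" z] B_A[of x] by simp

lemma closure_D: "closure D = UNIV"
  using D_dense by (simp add: densely_defined_def)

lemma B'_in_D': "B' z \<in> D'"
  using A_B' by (auto simp: adj_dom_def)

lemma A'_B': "A' (B' z) = z"
  by (rule adj_eqI[OF closure_D]) (rule A_B')

lemma B'_A':
  assumes "y \<in> D'"
  shows "B' (A' y) = y"
proof -
  obtain z where z: "\<And>x. x \<in> D \<Longrightarrow> cinner (A x) y = cinner x z"
    using assms by (auto simp: adj_dom_def)
  have A'y: "A' y = z" by (rule adj_eqI[OF closure_D z])
  have "cinner v (B' z) = cinner v y" for v
    using A_B'[OF B_in_D, of v z] z[OF B_in_D, of v] by (simp add: A_B)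
  thus ?thesis unfolding A'y by (rule cinner_eqI_dense[OF closure_UNIV])
qed

text \<open>The inverse of the adjoint is the adjoint of the inverse. Every vector of the domain
  \<open>D'\<close> is therefore of the form \<open>B' z\<close>, which turns the second hypothesis
  into one on the everywhere defined operator \<open>E' \<circ> B'\<close>.\<close>

lemma A'_bij: "bij_betw A' D' UNIV"
  by (rule bij_betw_byWitness[where f' = B']) (auto simp: A'_B' B'_A' B'_in_D')

sublocale S: inverse_dissipative "E \<circ> B" w
proof
  show "(E \<circ> B) (x + y) = (E \<circ> B) x + (E \<circ> B) y" for x y
    by (simp add: B_add linear_simps[OF bounded_clinear_bounded_linear[OF E]])
  show "(E \<circ> B) (c *\<^sub>C x) = c *\<^sub>C (E \<circ> B) x" for c x
    by (simp add: B_scaleC bounded_clinear_scaleC[OF E])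
  show "Re (cinner x ((E \<circ> B) x)) \<le> - w * (norm ((E \<circ> B) x))\<^sup>2" for x
    using diss[OF B_in_D, of x] by (simp add: A_B)
qed (rule w_pos)

sublocale K: inverse_dissipative "E' \<circ> B'" w
proof
  show "Re (cinner x ((E' \<circ> B') x)) \<le> - w * (norm ((E' \<circ> B') x))\<^sup>2" for x
    using adj_diss[OF B'_in_D', of x] by (simp add: A'_B')
qed (simp_all add: adj_add adj_scaleC E bounded_clinear_B w_pos)

sublocale Q: inverse_dissipative "B \<circ> E" w
proof
  show "(B \<circ> E) (x + y) = (B \<circ> E) x + (B \<circ> E) y" for x y
    by (simp add: B_add linear_simps[OF bounded_clinear_bounded_linear[OF E]])
  show "(B \<circ> E) (c *\<^sub>C x) = c *\<^sub>C (B \<circ> E) x" for c x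
    by (simp add: B_scaleC bounded_clinear_scaleC[OF E])
  have "cinner ((B \<circ> E) x) y = cinner x ((E' \<circ> B') y)" for x y
    by (simp add: cinner_adj[OF E] cinner_adj[OF bounded_clinear_B])
  thus "Re (cinner x ((B \<circ> E) x)) \<le> - w * (norm ((B \<circ> E) x))\<^sup>2" for x
    by (rule inverse_dissipative_adjoint[OF _ w_pos K.diss])
qed (rule w_pos)

lemma resolvent_set_real: "complex_of_real ` {- w<..} \<subseteq> resolvent_set E D A"
  using of_real_in_resolvent_set[OF S.inverse_dissipative_axioms A_bij B_A] by auto

lemma resolvent_set_adj_real: "complex_of_real ` {- w<..} \<subseteq> resolvent_set E' D' A'"
  using of_real_in_resolvent_set[OF K.inverse_dissipative_axioms A'_bij B'_A'] by auto

section \<open>Resolvents of the pair as fixed-point equations\<close>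

context
  fixes \<mu> :: complex
  assumes \<mu>: "\<mu> \<in> resolvent_set E D A"
begin

lemma pair_resolvent_in_D: "pair_resolvent E D A \<mu> z \<in> D"
  and pair_resolvent_right: "\<mu> *\<^sub>C E (pair_resolvent E D A \<mu> z) - A (pair_resolvent E D A \<mu> z) = z"
  and pair_resolvent_left: "x \<in> D \<Longrightarrow> pair_resolvent E D A \<mu> (\<mu> *\<^sub>C E x - A x) = x"
proof -
  have bij: "bij_betw (\<lambda>x. \<mu> *\<^sub>C E x - A x) D UNIV" using \<mu> by (simp add: resolvent_set_def)
  show "pair_resolvent E D A \<mu> z \<in> D"
    unfolding pair_resolvent_def using bij by (metis bij_betw_def inv_into_into UNIV_I)
  show "\<mu> *\<^sub>C E (pair_resolvent E D A \<mu> z) - A (pair_resolvent E D A \<mu> z) = z"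
    unfolding pair_resolvent_def using bij_betw_inv_into_right[OF bij, of z] by simp
  show "pair_resolvent E D A \<mu> (\<mu> *\<^sub>C E x - A x) = x" if "x \<in> D" for x
    unfolding pair_resolvent_def using bij_betw_inv_into_left[OF bij that] by simp
qed

lemma pseudo_resolvent_eq: "pseudo_resolvent E D A \<mu> v = - pair_resolvent E D A \<mu> (E v)"
proof -
  define x where "x = - pair_resolvent E D A \<mu> (E v)"
  have inj: "inj_on (\<lambda>x. A x - \<mu> *\<^sub>C E x) D"
    by (rule inj_onI) (metis minus_diff_eq pair_resolvent_left)
  have minus: "A (- y) = - A y" if "y \<in> D" for y
    using A_scaleC[OF that, of "-1"] by (simp add: scaleC_minus_one)
  have xD: "x \<in> D" unfolding x_def
    by (rule complex_vector.subspace_neg[OF subspace_D pair_resolvent_in_D])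
  have "A x - \<mu> *\<^sub>C E x = E v"
    using pair_resolvent_right[of "E v"] minus[OF pair_resolvent_in_D, of "E v"]
    by (simp add: x_def scaleC_minus_right linear_simps[OF bounded_clinear_bounded_linear[OF E]])
  thus ?thesis
    unfolding pseudo_resolvent_def using inv_into_f_f[OF inj xD] by (simp add: x_def)
qed

text \<open>The equation (A - mu E) y = E v is A y = E (v + mu y), and applying B removes the
  unbounded operator. It holds at every complex mu in the resolvent set, as the independence of mu
  in the definition of the degenerate semigroup demands.\<close>

lemma pseudo_resolvent_iff:
  "pseudo_resolvent E D A \<mu> v = y \<longleftrightarrow> y = (B \<circ> E) (v + \<mu> *\<^sub>C y)"
proof -
  have E_add: "E (v + \<mu> *\<^sub>C y) = E v + \<mu> *\<^sub>C E y" for v y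
    by (simp add: linear_simps[OF bounded_clinear_bounded_linear[OF E]] bounded_clinear_scaleC[OF E])
  have E_neg: "E (- y) = - E y" for y
    by (simp add: linear_simps[OF bounded_clinear_bounded_linear[OF E]])
  have A_neg: "A (- y) = - A y" if "y \<in> D" for y
    using A_scaleC[OF that, of "-1"] by (simp add: scaleC_minus_one)
  have D_neg: "- y \<in> D" if "y \<in> D" for y
    by (rule complex_vector.subspace_neg[OF subspace_D that])
  have "pseudo_resolvent E D A \<mu> v = y \<longleftrightarrow> pair_resolvent E D A \<mu> (E v) = - y"
    unfolding pseudo_resolvent_eq by (metis minus_minus)
  also have "\<dots> \<longleftrightarrow> - y \<in> D \<and> \<mu> *\<^sub>C E (- y) - A (- y) = E v"
    using pair_resolvent_in_D pair_resolvent_right pair_resolvent_left by metis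
  also have "\<dots> \<longleftrightarrow> y \<in> D \<and> A y = E v + \<mu> *\<^sub>C E y"
  proof -
    have "- y \<in> D \<longleftrightarrow> y \<in> D" using D_neg[of y] D_neg[of "- y"] by auto
    moreover have "\<mu> *\<^sub>C E (- y) - A (- y) = E v \<longleftrightarrow> A y = E v + \<mu> *\<^sub>C E y" if "y \<in> D"
      unfolding E_neg A_neg[OF that] scaleC_minus_right by (auto simp: algebra_simps)
    ultimately show ?thesis by blast
  qed
  also have "\<dots> \<longleftrightarrow> y = B (E v + \<mu> *\<^sub>C E y)"
    using A_B B_A B_in_D by metis
  finally show ?thesis by (simp add: E_add)
qed

end

lemma E_pair_resolvent:
  assumes l: "l > - w"
  shows "bounded_clinear (E \<circ> pair_resolvent E D A (complex_of_real l))"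
    and "onorm (E \<circ> pair_resolvent E D A (complex_of_real l)) \<le> inverse (l + w)"
proof -
  define R where "R = pair_resolvent E D A (complex_of_real l)"
  have mem: "complex_of_real l \<in> resolvent_set E D A" using resolvent_set_real l by auto
  note R = pair_resolvent_in_D[OF mem, folded R_def] pair_resolvent_right[OF mem, folded R_def]
    scaleR_scaleC[symmetric]
  have "(E \<circ> B) (A (R z)) = E (R z)" for z by (simp add: B_A R(1))
  \<comment> \<open>From (l E - A) R z = z follows R z = - B (z - l E R z). So - E R solves the
    fixed-point equation of a pseudo-resolvent on Z, with E B in the place of Q.\<close>
  have char: "- (E \<circ> R) z = (E \<circ> B) (z + l *\<^sub>R (- (E \<circ> R) z))" for z
  proof -
    have "z + l *\<^sub>R (- E (R z)) = (- 1) *\<^sub>C A (R z)"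
      using R(2)[of z] by (simp add: scaleR_scaleC scaleC_minus_right scaleC_minus_one algebra_simps)
    hence "B (z + l *\<^sub>R (- E (R z))) = - R z"
      by (simp only: B_scaleC B_A[OF R(1)]) (simp add: scaleC_minus_one)
    moreover have "E (- R z) = - E (R z)"
      using bounded_clinear_scaleC[OF E, of "-1" "R z"] by (simp add: scaleC_minus_one)
    ultimately show ?thesis by (simp only: comp_def)
  qed
  note neg = S.resolvent_bounded[OF l, of "\<lambda>z. - (E \<circ> R) z", OF char]
  show "bounded_clinear (E \<circ> R)"
    using bounded_clinear_minus[OF neg(1)] by (simp add: comp_def)
  show "onorm (E \<circ> R) \<le> inverse (l + w)"
    using neg(2) by (simp only: onorm_neg)
qed

lemma pair_resolvent_E:
  assumes l: "l > - w"
  shows "bounded_clinear (pair_resolvent E D A (complex_of_real l) \<circ> E)"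
    and "onorm (pair_resolvent E D A (complex_of_real l) \<circ> E) \<le> inverse (l + w)"
proof -
  define R where "R = pseudo_resolvent E D A (complex_of_real l)"
  have mem: "complex_of_real l \<in> resolvent_set E D A" using resolvent_set_real l by auto
  have "R v = (B \<circ> E) (v + l *\<^sub>R R v)" for v
    unfolding scaleR_scaleC R_def by (rule pseudo_resolvent_iff[OF mem, THEN iffD1, OF refl])
  note bounded = Q.resolvent_bounded[OF l this]
  have eq: "pair_resolvent E D A (complex_of_real l) \<circ> E = (\<lambda>v. - R v)"
    by (simp add: fun_eq_iff R_def pseudo_resolvent_eq[OF mem])
  show "bounded_clinear (pair_resolvent E D A (complex_of_real l) \<circ> E)"
    unfolding eq by (rule bounded_clinear_minus[OF bounded(1)])
  show "onorm (pair_resolvent E D A (complex_of_real l) \<circ> E) \<le> inverse (l + w)"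
    unfolding eq onorm_neg by (rule bounded(2))
qed

end

theorem corollary3p2:
  fixes E :: "'x::complex_hilbert \<Rightarrow> 'z::complex_hilbert"
    and D :: "'x set" and A :: "'x \<Rightarrow> 'z" and \<omega> :: real
  assumes "bounded_clinear E"
    and "clinear_on D A" and "closed_op D A" and "densely_defined D"
    and "bij_betw A D UNIV"
    and "\<omega> > 0"
    and "\<forall>x\<in>D. Re (cinner (A x) (E x)) \<le> - \<omega> * (norm (E x))\<^sup>2"
    and "\<forall>y\<in>adj_dom D A.
           Re (cinner (adj D A y) (adj UNIV E y)) \<le> - \<omega> * (norm (adj UNIV E y))\<^sup>2"
  shows "(complex_of_real ` {- \<omega><..} \<subseteq> resolvent_set E D A \<and>
         complex_of_real ` {- \<omega><..} \<subseteq> resolvent_set (adj UNIV E) (adj_dom D A) (adj D A)) \<and>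
         (\<forall>\<mu>>- \<omega>. bounded_clinear (E \<circ> pair_resolvent E D A (complex_of_real \<mu>)) \<and>
           onorm (E \<circ> pair_resolvent E D A (complex_of_real \<mu>)) \<le> inverse (\<mu> + \<omega>)) \<and>
         (\<forall>\<mu>>- \<omega>. bounded_clinear (pair_resolvent E D A (complex_of_real \<mu>) \<circ> E) \<and>
           onorm (pair_resolvent E D A (complex_of_real \<mu>) \<circ> E) \<le> inverse (\<mu> + \<omega>)) \<and>
         (\<exists>T. degenerate_semigroup (resolvent_set E D A) (pseudo_resolvent E D A) T) \<and>
         (\<forall>T. degenerate_semigroup (resolvent_set E D A) (pseudo_resolvent E D A) T \<longrightarrow>
            exponentially_stable T)"
proof -
  interpret dissipative_pair E D A \<omega>
    by unfold_locales (use assms in auto)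
  have "\<exists>T. degenerate_semigroup (resolvent_set E D A) (pseudo_resolvent E D A) T"
    by (rule exI, rule Q.degenerate_semigroup_exists[OF pseudo_resolvent_iff resolvent_set_real])
  moreover have "exponentially_stable T"
    if "degenerate_semigroup (resolvent_set E D A) (pseudo_resolvent E D A) T" for T
    by (rule Q.degenerate_semigroup_stable[OF pseudo_resolvent_iff that])
  ultimately show ?thesis
    using resolvent_set_real resolvent_set_adj_real E_pair_resolvent pair_resolvent_E
    by (intro conjI allI impI)
qed

end
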